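(* Let $\varphi:\mathbb{P}^1_K\rightarrow\mathbb{P}^1_K$ be a morphism of degree $d>1$ and let $\mathfrak{f}_\varphi$ be the conductor of $\varphi$. Let $\mathfrak{U}_\varphi=C\setminus\mathrm{Supp}(\mathfrak{f}_\varphi)$ be the set of points of $C$ where $\varphi$ has good reduction, and let $\Phi=[\mathbf a,\mathbf b]$ be a semi-stable presentation of $\varphi$. Let $U_\Phi$ be the open set of points of $C$ at which $\Phi$ has non-singular reduction. Then $U_\Phi=\mathfrak{U}_\varphi$.
   Context: Setting: $C$ is a noetherian integral one-dimensional scheme whose local rings at closed points are discrete valuation rings, and $K$ is its function field, of characteristic $0$ (e.g. $C=\mathrm{Spec}(\mathcal{O}_K)$ for a number field $K$, or a nonsingular curve over an algebraically closed field of characteristic $0$). For a closed point $p\in C$, $v_p$ is the normalized valuation of $\mathcal{O}_{C,p}$ and $\kappa(p)$ the residue field. Presentations: fix coordinates $[X,Y]$ on $\mathbb{P}^1_K$. A presentation of a degree $d$ morphism $\varphi$ is the point $\Phi=[\mathbf{a},\mathbf{b}]=[a_0,\dots,a_d,b_0,\dots,b_d]\in\mathbb{P}^{2d+1}(K)$ of coefficients of homogeneous forms $F_{\mathbf a}=\sum a_iX^{d-i}Y^i$, $F_{\mathbf b}=\sum b_iX^{d-i}Y^i$ without common zero in $\mathbb{P}^1(\bar K)$ with $\varphi=[F_{\mathbf a}:F_{\mathbf b}]$. A model of $\Phi$ is an affine representative $(\mathbf a,\mathbf b)\in K^{2d+2}$. $\rho(\mathbf a,\mathbf b)$ denotes the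 resultant of $F_{\mathbf a},F_{\mathbf b}$ as forms of degree $d$ (the $2d\times 2d$ Sylvester determinant). Action: for $\Gamma=\begin{pmatrix}\alpha&\beta\\ \gamma&\delta\end{pmatrix}\in\mathrm{GL}_2(K)$, $(\mathbf a^\Gamma,\mathbf b^\Gamma)$ are the coefficients of $\Gamma^{\mathrm{adj}}\cdot\big(F_{\mathbf a}(\alpha X+\beta Y,\gamma X+\delta Y),\,F_{\mathbf b}(\alpha X+\beta Y,\gamma X+\delta Y)\big)^T$, with $\Gamma^{\mathrm{adj}}=\begin{pmatrix}\delta&-\beta\\-\gamma&\alpha\end{pmatrix}$; this induces the conjugation action $\Phi\mapsto\Phi^\Gamma$ of $\mathrm{PGL}_2(K)$; the conjugates $\Phi^\Gamma$ are also regarded as presentations of $\varphi$ (in other coordinates). Resultants and reduction types: $n_p(\mathbf a,\mathbf b)$ is the minimum of $v_p$ over all coordinates, and $N_{\Phi,p}=v_p(\rho(\mathbf a,\mathbf b))-2d\,n_p(\mathbf a,\mathbf b)\ge 0$ (independent of the model). $\Phi$ has singular reduction at $p$ if $N_{\Phi,p}>0$ and non-singular reduction if $N_{\Phi,p}=0$. The minimal resultant is $R_\varphi=\sum_p\min_{\Gamma\in \mathrm{PGL}_2(K)}N_{\Phi^\Gamma,p}\,[p]$; the conductor is $\mathfrak{f}_\varphi=\sum_{p\in\mathrm{Supp}(R_\varphi)}[p]$; $\varphi$ has bad reduction at $p$ if $p\in\mathrm{Supp}(\mathfrak{f}_\varphi)$ and good reduction otherwise. Semi-stability: scaling a model so that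 $n_p=0$ and reducing the coordinates modulo $p$ gives the reduction $\Phi_p\in\mathbb{P}^{2d+1}(\kappa(p))$. A point of $\mathbb{P}^{2d+1}(F)$, $F$ a field, is unstable if over $\bar F$ it is $\mathrm{SL}_2(\bar F)$-conjugate to a point with $a_i=0$ for all $i\le\frac{d-1}{2}$ and $b_j=0$ for all $j\le\frac{d+1}{2}$; otherwise it is semi-stable (this is GIT semi-stability for the conjugation action). $\Phi$ is a semi-stable presentation if the unique morphism $C\to\mathbb{P}^{2d+1}$ extending $\Phi$ factors through the semi-stable locus, i.e. if $\Phi_p$ is semi-stable for every closed point $p\in C$. *)

theory Defs
  imports
    "HOL-Analysis.Abstract_Topology"
    "HOL-Analysis.Function_Topology"
    "HOL-Algebra.Algebraic_Closure_Type"
    "HOL-Algebra.UnivPoly"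
    "HOL-Algebra.Ring_Divisibility"
    "HOL-Algebra.QuotRing"
    "Subresultants.Resultant_Prelim"
begin

section \<open>Integral schemes with a given function field\<close>

text \<open>
  An integral scheme with function field \<open>'k\<close> is determined by its underlying space \<open>C\<close> together
  with its local rings, viewed as subrings \<open>\<O> x\<close> of \<open>'k\<close>: the sections over a nonempty open \<open>U\<close>
  are the intersection of the \<open>\<O> x\<close> for \<open>x \<in> U\<close>, and restriction maps are inclusions. The points
  include the generic point. Different points may have the same local ring, so \<open>C\<close> need not be
  separated.
\<close>

abbreviation base_field :: "'k::field_char_0 ring" where
  "base_field \<equiv> ring_of_type_algebra"

abbreviation sub_ring :: "'k::field_char_0 set \<Rightarrow> 'k ring" where
  "sub_ring A \<equiv> base_field\<lparr>carrier := A\<rparr>"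

definition spectrum :: "'k::field_char_0 set \<Rightarrow> 'k set set" where
  "spectrum A = {P. primeideal P (sub_ring A)}"

definition zariski_topology :: "'k::field_char_0 set \<Rightarrow> 'k set topology" where
  "zariski_topology A = topology_generated_by ((\<lambda>f. {P \<in> spectrum A. f \<notin> P}) ` A)"

definition localization_at :: "'k::field_char_0 set \<Rightarrow> 'k set \<Rightarrow> 'k set" where
  "localization_at A P = {a / s | a s. a \<in> A \<and> s \<in> A - P}"

definition affine_chart ::
    "'p topology \<Rightarrow> ('p \<Rightarrow> 'k::field_char_0 set) \<Rightarrow> 'p set \<Rightarrow> 'k set \<Rightarrow> bool" where
  "affine_chart C \<O> U A \<longleftrightarrow>
     openin C U \<and> subring A base_field \<and> (\<forall>z. \<exists>a\<in>A. \<exists>b\<in>A. b \<noteq> 0 \<and> z = a / b) \<and>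
     (\<exists>h. homeomorphic_map (subtopology C U) (zariski_topology A) h \<and>
          (\<forall>x\<in>U. \<O> x = localization_at A (h x)))"

definition irreducible_in :: "'p topology \<Rightarrow> 'p set \<Rightarrow> bool" where
  "irreducible_in C Z \<longleftrightarrow> Z \<noteq> {} \<and> Z \<subseteq> topspace C \<and>
     (\<forall>Z1 Z2. closedin C Z1 \<and> closedin C Z2 \<and> Z \<subseteq> Z1 \<union> Z2 \<longrightarrow> Z \<subseteq> Z1 \<or> Z \<subseteq> Z2)"

definition noetherian_integral_scheme :: "'p topology \<Rightarrow> ('p \<Rightarrow> 'k::field_char_0 set) \<Rightarrow> bool" where
  "noetherian_integral_scheme C \<O> \<longleftrightarrow>
     irreducible_in C (topspace C) \<and> compact_space C \<and>
     (\<forall>x\<in>topspace C. \<exists>U A. x \<in> U \<and> affine_chart C \<O> U A \<and> noetherian_ring (sub_ring A))"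

definition has_closed_chain :: "'p topology \<Rightarrow> nat \<Rightarrow> bool" where
  "has_closed_chain C n \<longleftrightarrow>
     (\<exists>Z. (\<forall>i\<le>n. closedin C (Z i) \<and> irreducible_in C (Z i)) \<and> (\<forall>i<n. Z i \<subset> Z (Suc i)))"

definition one_dimensional :: "'p topology \<Rightarrow> bool" where
  "one_dimensional C \<longleftrightarrow> has_closed_chain C 1 \<and> \<not> has_closed_chain C 2"

definition closed_points :: "'p topology \<Rightarrow> 'p set" where
  "closed_points C = {p. closedin C {p}}"

definition discrete_valuation_ring :: "('a, 'm) ring_scheme \<Rightarrow> bool" where
  "discrete_valuation_ring R \<longleftrightarrow>
     principal_domain R \<and> \<not> field R \<and> (\<exists>!M. maximalideal M R)"

definition dvr_curve :: "'p topology \<Rightarrow> ('p \<Rightarrow> 'k::field_char_0 set) \<Rightarrow> bool" where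
  "dvr_curve C \<O> \<longleftrightarrow>
     noetherian_integral_scheme C \<O> \<and> one_dimensional C \<and>
     (\<forall>p\<in>closed_points C. discrete_valuation_ring (sub_ring (\<O> p)))"

section \<open>Valuation and residue field of a discrete valuation ring in the base field\<close>

definition max_ideal :: "'k::field_char_0 set \<Rightarrow> 'k set" where
  "max_ideal S = (THE M. maximalideal M (sub_ring S))"

definition uniformizer :: "'k::field_char_0 set \<Rightarrow> 'k \<Rightarrow> bool" where
  "uniformizer S t \<longleftrightarrow> t \<in> S \<and> max_ideal S = PIdl\<^bsub>sub_ring S\<^esub> t"

text \<open>The value at \<open>0\<close>, which should be infinite, is left unspecified.\<close>

definition val :: "'k::field_char_0 set \<Rightarrow> 'k \<Rightarrow> int" where
  "val S x = (THE n. \<exists>t u. uniformizer S t \<and> u \<in> Units (sub_ring S) \<and> x = u * t powi n)"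

definition residue_field :: "'k::field_char_0 set \<Rightarrow> 'k set ring" where
  "residue_field S = sub_ring S Quot max_ideal S"

definition residue :: "'k::field_char_0 set \<Rightarrow> 'k \<Rightarrow> 'k set" where
  "residue S x = max_ideal S +>\<^bsub>sub_ring S\<^esub> x"

section \<open>Pairs of forms and the conjugation action\<close>

text \<open>
  A binary form of degree \<open>d\<close> is given by the function sending \<open>i\<close> to the coefficient of
  \<open>X\<^sup>d\<^sup>-\<^sup>iY\<^sup>i\<close>; only the values at \<open>i \<le> d\<close> are meaningful. A model is a pair of such functions. A point
  of projective \<open>(2d+1)\<close>-space is represented by any of its models. A matrix with rows
  \<open>(\<alpha>, \<beta>)\<close> and \<open>(\<gamma>, \<delta>)\<close> is the tuple \<open>(\<alpha>, \<beta>, \<gamma>, \<delta>)\<close>.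
\<close>

type_synonym 'a form = "nat \<Rightarrow> 'a"
type_synonym 'a model = "'a form \<times> 'a form"
type_synonym 'a matrix2 = "'a \<times> 'a \<times> 'a \<times> 'a"

fun GL2 :: "('a, 'm) ring_scheme \<Rightarrow> 'a matrix2 \<Rightarrow> bool" where
  "GL2 R (\<alpha>, \<beta>, \<gamma>, \<delta>) \<longleftrightarrow> {\<alpha>, \<beta>, \<gamma>, \<delta>} \<subseteq> carrier R \<and>
     \<alpha> \<otimes>\<^bsub>R\<^esub> \<delta> \<ominus>\<^bsub>R\<^esub> \<beta> \<otimes>\<^bsub>R\<^esub> \<gamma> \<in> Units R"

fun SL2 :: "('a, 'm) ring_scheme \<Rightarrow> 'a matrix2 \<Rightarrow> bool" where
  "SL2 R (\<alpha>, \<beta>, \<gamma>, \<delta>) \<longleftrightarrow> {\<alpha>, \<beta>, \<gamma>, \<delta>} \<subseteq> carrier R \<and>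
     \<alpha> \<otimes>\<^bsub>R\<^esub> \<delta> \<ominus>\<^bsub>R\<^esub> \<beta> \<otimes>\<^bsub>R\<^esub> \<gamma> = \<one>\<^bsub>R\<^esub>"

text \<open>
  Coefficients of \<open>F(\<alpha>X + \<beta>Y, \<gamma>X + \<delta>Y)\<close>, computed after setting \<open>X = 1\<close>: the coefficient of
  \<open>X\<^sup>d\<^sup>-\<^sup>kY\<^sup>k\<close> is that of \<open>Y\<^sup>k\<close> in the sum over \<open>i \<le> d\<close> of \<open>a\<^sub>i(\<alpha> + \<beta>Y)\<^sup>d\<^sup>-\<^sup>i(\<gamma> + \<delta>Y)\<^sup>i\<close>.
\<close>

fun form_subst :: "('a, 'm) ring_scheme \<Rightarrow> nat \<Rightarrow> 'a matrix2 \<Rightarrow> 'a form \<Rightarrow> 'a form" where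
  "form_subst R d (\<alpha>, \<beta>, \<gamma>, \<delta>) a = up_ring.coeff (UP R)
     (\<Oplus>\<^bsub>UP R\<^esub> i\<in>{..d}. a i \<odot>\<^bsub>UP R\<^esub>
        ((up_ring.monom (UP R) \<alpha> 0 \<oplus>\<^bsub>UP R\<^esub> up_ring.monom (UP R) \<beta> 1) [^]\<^bsub>UP R\<^esub> (d - i)
         \<otimes>\<^bsub>UP R\<^esub>
         (up_ring.monom (UP R) \<gamma> 0 \<oplus>\<^bsub>UP R\<^esub> up_ring.monom (UP R) \<delta> 1) [^]\<^bsub>UP R\<^esub> i))"

fun conj_model :: "('a, 'm) ring_scheme \<Rightarrow> nat \<Rightarrow> 'a matrix2 \<Rightarrow> 'a model \<Rightarrow> 'a model" where
  "conj_model R d (\<alpha>, \<beta>, \<gamma>, \<delta>) (a, b) =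
     (let A = form_subst R d (\<alpha>, \<beta>, \<gamma>, \<delta>) a; B = form_subst R d (\<alpha>, \<beta>, \<gamma>, \<delta>) b
      in (\<lambda>k. \<delta> \<otimes>\<^bsub>R\<^esub> A k \<ominus>\<^bsub>R\<^esub> \<beta> \<otimes>\<^bsub>R\<^esub> B k,
          \<lambda>k. \<ominus>\<^bsub>R\<^esub> (\<gamma> \<otimes>\<^bsub>R\<^esub> A k) \<oplus>\<^bsub>R\<^esub> \<alpha> \<otimes>\<^bsub>R\<^esub> B k))"

section \<open>Morphisms of the projective line and their presentations\<close>

text \<open>
  A morphism of the projective line over \<open>'k\<close> is identified with the map it induces on points over
  the algebraic closure (it is determined by this map). A point \<open>[x:y]\<close> is the set of its
  pairs of homogeneous coordinates; values of \<open>\<phi>\<close> on other sets are irrelevant.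
\<close>

definition proj_point :: "'a::field \<Rightarrow> 'a \<Rightarrow> ('a \<times> 'a) set" where
  "proj_point x y = {(c * x, c * y) | c. c \<noteq> 0}"

type_synonym 'k line_map =
  "('k alg_closure \<times> 'k alg_closure) set \<Rightarrow> ('k alg_closure \<times> 'k alg_closure) set"

definition form_eval ::
    "nat \<Rightarrow> 'k::field_char_0 form \<Rightarrow> 'k alg_closure \<Rightarrow> 'k alg_closure \<Rightarrow> 'k alg_closure" where
  "form_eval d a x y = (\<Sum>i\<le>d. to_ac (a i) * x ^ (d - i) * y ^ i)"

text \<open>Presentations in the fixed coordinates \<open>[X, Y]\<close>.\<close>

fun fixed_presentation :: "nat \<Rightarrow> 'k::field_char_0 line_map \<Rightarrow> 'k model \<Rightarrow> bool" where
  "fixed_presentation d \<phi> (a, b) \<longleftrightarrow>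
     (\<forall>x y. (x, y) \<noteq> (0, 0) \<longrightarrow>
        (form_eval d a x y, form_eval d b x y) \<noteq> (0, 0) \<and>
        \<phi> (proj_point x y) = proj_point (form_eval d a x y) (form_eval d b x y))"

definition morphism_of_degree :: "nat \<Rightarrow> 'k::field_char_0 line_map \<Rightarrow> bool" where
  "morphism_of_degree d \<phi> \<longleftrightarrow> (\<exists>\<Phi>. fixed_presentation d \<phi> \<Phi>)"

text \<open>
  Presentations in arbitrary coordinates. Scaling needs no separate mention, since
  \<^const>\<open>fixed_presentation\<close> is invariant under it.
\<close>

definition presentation :: "nat \<Rightarrow> 'k::field_char_0 line_map \<Rightarrow> 'k model \<Rightarrow> bool" where
  "presentation d \<phi> \<Psi> \<longleftrightarrow>
     (\<exists>\<Phi> \<Gamma>. fixed_presentation d \<phi> \<Phi> \<and> GL2 base_field \<Gamma> \<and>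
        (\<forall>i\<le>d. fst \<Psi> i = fst (conj_model base_field d \<Gamma> \<Phi>) i \<and>
               snd \<Psi> i = snd (conj_model base_field d \<Gamma> \<Phi>) i))"

section \<open>Resultants, reduction types and the conductor\<close>

definition dehomogenize :: "nat \<Rightarrow> 'k::field_char_0 form \<Rightarrow> 'k poly" where
  "dehomogenize d a = (\<Sum>i\<le>d. Polynomial.monom (a i) (d - i))"

fun form_resultant :: "nat \<Rightarrow> 'k::field_char_0 model \<Rightarrow> 'k" where
  "form_resultant d (a, b) = det (sylvester_mat_sub d d (dehomogenize d a) (dehomogenize d b))"

text \<open>Zero coordinates have infinite valuation and do not contribute to the minimum.\<close>

fun min_val :: "'k::field_char_0 set \<Rightarrow> nat \<Rightarrow> 'k model \<Rightarrow> int" where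
  "min_val S d (a, b) = Min (val S ` (a ` {..d} \<union> b ` {..d} - {0}))"

definition resultant_exponent :: "'k::field_char_0 set \<Rightarrow> nat \<Rightarrow> 'k model \<Rightarrow> int" where
  "resultant_exponent S d \<Phi> = val S (form_resultant d \<Phi>) - 2 * int d * min_val S d \<Phi>"

text \<open>Divisors are functions on points, supported on closed points.\<close>

definition divisor_support :: "('p \<Rightarrow> int) \<Rightarrow> 'p set" where
  "divisor_support D = {p. D p \<noteq> 0}"

definition minimal_resultant ::
    "'p topology \<Rightarrow> ('p \<Rightarrow> 'k::field_char_0 set) \<Rightarrow> nat \<Rightarrow> 'k line_map \<Rightarrow> 'p \<Rightarrow> int" where
  "minimal_resultant C \<O> d \<phi> p =
     (if p \<in> closed_points C
      then INF \<Psi>\<in>{\<Psi>. presentation d \<phi> \<Psi>}. resultant_exponent (\<O> p) d \<Psi> else 0)"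

definition conductor ::
    "'p topology \<Rightarrow> ('p \<Rightarrow> 'k::field_char_0 set) \<Rightarrow> nat \<Rightarrow> 'k line_map \<Rightarrow> 'p \<Rightarrow> int" where
  "conductor C \<O> d \<phi> p = (if p \<in> divisor_support (minimal_resultant C \<O> d \<phi>) then 1 else 0)"

definition good_reduction_locus ::
    "'p topology \<Rightarrow> ('p \<Rightarrow> 'k::field_char_0 set) \<Rightarrow> nat \<Rightarrow> 'k line_map \<Rightarrow> 'p set" where
  "good_reduction_locus C \<O> d \<phi> = topspace C - divisor_support (conductor C \<O> d \<phi>)"

text \<open>The generic point always belongs to the locus: reduction is only tested at closed points.\<close>

definition nonsingular_locus ::
    "'p topology \<Rightarrow> ('p \<Rightarrow> 'k::field_char_0 set) \<Rightarrow> nat \<Rightarrow> 'k model \<Rightarrow> 'p set" where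
  "nonsingular_locus C \<O> d \<Phi> =
     {x \<in> topspace C. x \<in> closed_points C \<longrightarrow> resultant_exponent (\<O> x) d \<Phi> = 0}"

section \<open>Semi-stability\<close>

text \<open>
  \<^const>\<open>ring.indexed_const\<close> is the embedding of a field into its \<^const>\<open>field.alg_closure\<close>.
\<close>

fun unstable :: "('a, 'm) ring_scheme \<Rightarrow> nat \<Rightarrow> 'a model \<Rightarrow> bool" where
  "unstable F d (a, b) \<longleftrightarrow>
     (\<exists>\<Gamma> a' b'. SL2 (field.alg_closure F) \<Gamma> \<and>
        conj_model (field.alg_closure F) d \<Gamma>
          (\<lambda>i. ring.indexed_const F (a i), \<lambda>i. ring.indexed_const F (b i)) = (a', b') \<and>
        (\<forall>i\<le>d. real i \<le> (real d - 1) / 2 \<longrightarrow> a' i = \<zero>\<^bsub>field.alg_closure F\<^esub>) \<and>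
        (\<forall>j\<le>d. real j \<le> (real d + 1) / 2 \<longrightarrow> b' j = \<zero>\<^bsub>field.alg_closure F\<^esub>))"

fun semistable_reduction :: "'k::field_char_0 set \<Rightarrow> nat \<Rightarrow> 'k model \<Rightarrow> bool" where
  "semistable_reduction S d (a, b) \<longleftrightarrow>
     (\<exists>c. c \<noteq> 0 \<and> min_val S d (\<lambda>i. c * a i, \<lambda>i. c * b i) = 0 \<and>
        \<not> unstable (residue_field S) d
            (\<lambda>i. residue S (c * a i), \<lambda>i. residue S (c * b i)))"

definition semistable_presentation ::
    "'p topology \<Rightarrow> ('p \<Rightarrow> 'k::field_char_0 set) \<Rightarrow> nat \<Rightarrow> 'k line_map \<Rightarrow> 'k model \<Rightarrow> bool" where
  "semistable_presentation C \<O> d \<phi> \<Phi> \<longleftrightarrow>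
     presentation d \<phi> \<Phi> \<and> (\<forall>p\<in>closed_points C. semistable_reduction (\<O> p) d \<Phi>)"

end

(*
  Two presentations of the same morphism differ by a scalar and a matrix Gamma in GL_2(K). At a
  closed point with local ring S, the Smith normal form gives Gamma = l U diag(t, 1) W with l in K,
  t in S and U, W in SL_2(S). Start from a model over S whose resultant is a unit. Conjugation by
  GL_2(S) preserves these properties, so if t is a unit, the conjugate by Gamma has non-singular
  reduction as well. If t is not a unit, conjugation by diag(t, 1) turns the coordinates a_i, b_i
  into t^(d-i) a_i, t^(d+1-i) b_i. One of a_d, b_d is a unit, so any scalar k making these
  coordinates integral has k t in S. Hence those with i <= d-2, respectively i <= d-1, vanish
  modulo p, which makes the reduction unstable because d > 1. Therefore a semi-stable presentation
  has non-singular reduction wherever some presentation does.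
*)

theory Submission
  imports Defs
begin

text \<open>The property "the resultant is a unit of S" is carried through conjugation in a
  reformulated shape: every form of degree 2d-1 with coefficients in S is a combination of the two
  given forms, with cofactors of degree d-1 over S. Invertible substitutions visibly preserve this.
  The coefficient of Y^(2d-1) in such a combination also produces the unit among a_d, b_d, and
  taking S = K shows that every presentation has nonzero resultant. The weights d-i and d+1-i differ
  because the adjugate of diag(t, 1) is diag(1, t). The scalar k is a priori any element of K and
  may have a pole: integrality of k a_d or of k t b_d bounds that pole by one factor t. A coordinate
  of weight at least 2 therefore keeps a spare factor t. For d > 1 no integer up to (d-1)/2 exceeds
  d-2 and none up to (d+1)/2 exceeds d-1, so all coordinates in the definition of instability have
  weight at least 2. These coordinates become visible after undoing W; the destabilizing matrix is
  the reduction of the inverse of W, which has determinant 1.\<close>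

section \<open>Homogeneous substitution in polynomials\<close>

text \<open>Dehomogenization at X = 1, so the index of a coefficient is its exponent of Y
  (\<open>dehomogenize\<close> sets Y = 1 instead). The degree of the form is not visible in the
  polynomial, hence the explicit degree bounds throughout.\<close>

definition form_poly :: "nat \<Rightarrow> 'a::comm_monoid_add form \<Rightarrow> 'a poly" where
  "form_poly d a = (\<Sum>i\<le>d. Polynomial.monom (a i) i)"

lemma coeff_form_poly: "Polynomial.coeff (form_poly d a) k = (if k \<le> d then a k else 0)"
proof -
  have "Polynomial.coeff (form_poly d a) k = (\<Sum>i\<le>d. if i = k then a i else 0)"
    by (simp add: form_poly_def coeff_sum)
  also have "\<dots> = (if k \<le> d then a k else 0)"
    by (simp add: sum.delta)
  finally show ?thesis .
qed

lemma degree_form_poly: "Polynomial.degree (form_poly d a) \<le> d"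
  by (rule degree_le) (simp add: coeff_form_poly)

lemma form_poly_coeff:
  assumes "Polynomial.degree p \<le> d"
  shows "form_poly d (Polynomial.coeff p) = p"
  using assms by (auto intro!: poly_eqI simp: coeff_form_poly coeff_eq_0)

lemma form_poly_eqI:
  assumes "\<And>i. i \<le> d \<Longrightarrow> a i = b i"
  shows "form_poly d a = form_poly d b"
  using assms by (auto intro!: poly_eqI simp: coeff_form_poly)

lemma form_poly_scale: "form_poly d (\<lambda>i. c * a i) = Polynomial.smult c (form_poly d a)"
  for c :: "'a::comm_ring_1"
  by (rule poly_eqI) (simp add: coeff_form_poly)

text \<open>
  The dehomogenization at \<open>X = 1\<close> of the form \<open>F(\<alpha>X + \<beta>Y, \<gamma>X + \<delta>Y)\<close>, where \<open>p\<close> is the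
  dehomogenization of a form \<open>F\<close> of degree \<open>n\<close>.
\<close>

fun hsubst :: "nat \<Rightarrow> 'a::comm_ring_1 matrix2 \<Rightarrow> 'a poly \<Rightarrow> 'a poly" where
  "hsubst n (\<alpha>, \<beta>, \<gamma>, \<delta>) p =
     (\<Sum>i\<le>n. Polynomial.smult (Polynomial.coeff p i) ([:\<alpha>, \<beta>:] ^ (n - i) * [:\<gamma>, \<delta>:] ^ i))"

declare hsubst.simps [simp del]

fun matrix2_mult :: "'a::comm_ring_1 matrix2 \<Rightarrow> 'a matrix2 \<Rightarrow> 'a matrix2" where
  "matrix2_mult (\<alpha>, \<beta>, \<gamma>, \<delta>) (\<alpha>', \<beta>', \<gamma>', \<delta>') =
     (\<alpha> * \<alpha>' + \<beta> * \<gamma>', \<alpha> * \<beta>' + \<beta> * \<delta>', \<gamma> * \<alpha>' + \<delta> * \<gamma>', \<gamma> * \<beta>' + \<delta> * \<delta>')"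

lemma hsubst_add: "hsubst n \<Gamma> (p + q) = hsubst n \<Gamma> p + hsubst n \<Gamma> q"
  by (cases \<Gamma>) (simp add: hsubst.simps smult_add_left sum.distrib)

lemma hsubst_smult: "hsubst n \<Gamma> (Polynomial.smult c p) = Polynomial.smult c (hsubst n \<Gamma> p)"
  by (cases \<Gamma>) (simp add: hsubst.simps smult_sum2)

lemma hsubst_0: "hsubst n \<Gamma> 0 = 0"
  by (cases \<Gamma>) (simp add: hsubst.simps)

lemma hsubst_diff: "hsubst n \<Gamma> (p - q) = hsubst n \<Gamma> p - hsubst n \<Gamma> q"
  using hsubst_add[of n \<Gamma> p "Polynomial.smult (-1) q"] hsubst_smult[of n \<Gamma> "-1" q] by simp

lemma hsubst_sum: "hsubst n \<Gamma> (\<Sum>i\<in>A. f i) = (\<Sum>i\<in>A. hsubst n \<Gamma> (f i))"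
  by (induction A rule: infinite_finite_induct) (simp_all add: hsubst_add hsubst_0)

lemma hsubst_monom:
  assumes "i \<le> n"
  shows "hsubst n (\<alpha>, \<beta>, \<gamma>, \<delta>) (Polynomial.monom c i) =
    Polynomial.smult c ([:\<alpha>, \<beta>:] ^ (n - i) * [:\<gamma>, \<delta>:] ^ i)"
proof -
  have "hsubst n (\<alpha>, \<beta>, \<gamma>, \<delta>) (Polynomial.monom c i) =
    (\<Sum>j\<le>n. if j = i then Polynomial.smult c ([:\<alpha>, \<beta>:] ^ (n - i) * [:\<gamma>, \<delta>:] ^ i) else 0)"
    unfolding hsubst.simps by (rule sum.cong) auto
  then show ?thesis
    using assms by simp
qed

text \<open>Both sides are bilinear in \<open>p\<close> and \<open>q\<close>, so monomials suffice.
  The formal degrees \<open>m\<close> and \<open>n\<close> may exceed the actual ones; it is the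
  formal degrees that add.\<close>

lemma hsubst_mult:
  assumes "Polynomial.degree p \<le> m" "Polynomial.degree q \<le> n"
  shows "hsubst (m + n) \<Gamma> (p * q) = hsubst m \<Gamma> p * hsubst n \<Gamma> q"
proof -
  obtain \<alpha> \<beta> \<gamma> \<delta> where \<Gamma>: "\<Gamma> = (\<alpha>, \<beta>, \<gamma>, \<delta>)"
    by (cases \<Gamma>)
  have p: "p = (\<Sum>i\<le>m. Polynomial.monom (Polynomial.coeff p i) i)"
    and q: "q = (\<Sum>j\<le>n. Polynomial.monom (Polynomial.coeff q j) j)"
    using poly_as_sum_of_monoms'[OF assms(1)] poly_as_sum_of_monoms'[OF assms(2)] by simp_all
  have "hsubst (m + n) \<Gamma> (p * q) = hsubst (m + n) \<Gamma>
      (\<Sum>i\<le>m. \<Sum>j\<le>n. Polynomial.monom (Polynomial.coeff p i) i * Polynomial.monom (Polynomial.coeff q j) j)"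
    by (subst p, subst q) (simp only: sum_product)
  also have "\<dots> = (\<Sum>i\<le>m. \<Sum>j\<le>n. hsubst m \<Gamma> (Polynomial.monom (Polynomial.coeff p i) i) *
      hsubst n \<Gamma> (Polynomial.monom (Polynomial.coeff q j) j))"
    unfolding hsubst_sum
  proof (intro sum.cong refl)
    fix i j assume "i \<in> {..m}" "j \<in> {..n}"
    then have ij: "i \<le> m" "j \<le> n" "i + j \<le> m + n" and e: "m + n - (i + j) = (m - i) + (n - j)"
      by auto
    show "hsubst (m + n) \<Gamma> (Polynomial.monom (Polynomial.coeff p i) i * Polynomial.monom (Polynomial.coeff q j) j)
      = hsubst m \<Gamma> (Polynomial.monom (Polynomial.coeff p i) i) *
        hsubst n \<Gamma> (Polynomial.monom (Polynomial.coeff q j) j)"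
      unfolding \<Gamma> mult_monom hsubst_monom[OF ij(1)] hsubst_monom[OF ij(2)] hsubst_monom[OF ij(3)] e power_add
      by (simp add: ac_simps)
  qed
  also have "\<dots> = hsubst m \<Gamma> p * hsubst n \<Gamma> q"
    by (subst (2) p, subst (2) q) (simp only: sum_product hsubst_sum)
  finally show ?thesis .
qed

lemma degree_linear_power: "Polynomial.degree ([:a, b:] ^ i) \<le> i"
proof -
  have "Polynomial.degree ([:a, b:] ^ i) \<le> Polynomial.degree [:a, b:] * i"
    by (rule degree_power_le)
  also have "\<dots> \<le> 1 * i"
    by (intro mult_right_mono) auto
  finally show ?thesis by simp
qed

lemma degree_hsubst: "Polynomial.degree (hsubst n \<Gamma> p) \<le> n"
proof -
  obtain \<alpha> \<beta> \<gamma> \<delta> where \<Gamma>: "\<Gamma> = (\<alpha>, \<beta>, \<gamma>, \<delta>)"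
    by (cases \<Gamma>)
  have "Polynomial.degree (Polynomial.smult (Polynomial.coeff p i) ([:\<alpha>, \<beta>:] ^ (n - i) * [:\<gamma>, \<delta>:] ^ i)) \<le> n"
    if "i \<le> n" for i
  proof -
    have "Polynomial.degree ([:\<alpha>, \<beta>:] ^ (n - i) * [:\<gamma>, \<delta>:] ^ i) \<le> (n - i) + i"
      using degree_mult_le degree_linear_power by (meson add_mono order_trans)
    then show ?thesis
      using that degree_smult_le order_trans by fastforce
  qed
  then show ?thesis
    unfolding \<Gamma> hsubst.simps by (auto intro!: degree_sum_le)
qed

lemma hsubst_power:
  assumes "Polynomial.degree p \<le> 1"
  shows "hsubst i \<Gamma> (p ^ i) = hsubst 1 \<Gamma> p ^ i"
proof (induction i)
  case 0
  show ?case by (cases \<Gamma>) (simp add: hsubst.simps)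
next
  case (Suc i)
  have "Polynomial.degree (p ^ i) \<le> i"
    using degree_power_le[of p i] mult_le_mono1[OF assms, of i] by linarith
  then have "hsubst (1 + i) \<Gamma> (p * p ^ i) = hsubst 1 \<Gamma> p * hsubst i \<Gamma> (p ^ i)"
    using assms by (intro hsubst_mult) auto
  then show ?case using Suc by simp
qed

lemma hsubst_linear:
  "hsubst 1 (\<alpha>', \<beta>', \<gamma>', \<delta>') [:\<alpha>, \<beta>:] = [:\<alpha> * \<alpha>' + \<beta> * \<gamma>', \<alpha> * \<beta>' + \<beta> * \<delta>':]"
  by (simp add: hsubst.simps atMost_Suc)

text \<open>Each summand of the inner substitution is a product of \<open>n\<close> linear forms, so
  multiplicativity reduces the claim to linear forms, where it is the product of matrices. The order
  of the factors makes this a right action.\<close>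

lemma hsubst_hsubst:
  "hsubst n \<Delta> (hsubst n \<Gamma> p) = hsubst n (matrix2_mult \<Gamma> \<Delta>) p"
proof -
  obtain \<alpha> \<beta> \<gamma> \<delta> where \<Gamma>: "\<Gamma> = (\<alpha>, \<beta>, \<gamma>, \<delta>)"
    by (cases \<Gamma>)
  obtain \<alpha>' \<beta>' \<gamma>' \<delta>' where \<Delta>: "\<Delta> = (\<alpha>', \<beta>', \<gamma>', \<delta>')"
    by (cases \<Delta>)
  have *: "hsubst n \<Delta> ([:\<alpha>, \<beta>:] ^ (n - i) * [:\<gamma>, \<delta>:] ^ i) =
     hsubst 1 \<Delta> [:\<alpha>, \<beta>:] ^ (n - i) * hsubst 1 \<Delta> [:\<gamma>, \<delta>:] ^ i" if "i \<le> n" for i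
  proof -
    have "hsubst ((n - i) + i) \<Delta> ([:\<alpha>, \<beta>:] ^ (n - i) * [:\<gamma>, \<delta>:] ^ i) =
      hsubst (n - i) \<Delta> ([:\<alpha>, \<beta>:] ^ (n - i)) * hsubst i \<Delta> ([:\<gamma>, \<delta>:] ^ i)"
      by (intro hsubst_mult degree_linear_power)
    also have "\<dots> = hsubst 1 \<Delta> [:\<alpha>, \<beta>:] ^ (n - i) * hsubst 1 \<Delta> [:\<gamma>, \<delta>:] ^ i"
      by (simp add: hsubst_power)
    finally show ?thesis using that by simp
  qed
  have "hsubst n \<Delta> (hsubst n \<Gamma> p) = (\<Sum>i\<le>n. Polynomial.smult (Polynomial.coeff p i)
      (hsubst 1 \<Delta> [:\<alpha>, \<beta>:] ^ (n - i) * hsubst 1 \<Delta> [:\<gamma>, \<delta>:] ^ i))"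
    unfolding \<Gamma> hsubst.simps(1)[of n \<alpha> \<beta> \<gamma> \<delta>] hsubst_sum hsubst_smult using * by (intro sum.cong) auto
  also have "\<dots> = hsubst n (matrix2_mult \<Gamma> \<Delta>) p"
    unfolding \<Delta> hsubst_linear \<Gamma> by (simp add: hsubst.simps)
  finally show ?thesis .
qed

lemma matrix2_mult_assoc:
  "matrix2_mult (matrix2_mult A B) C = matrix2_mult A (matrix2_mult B C)"
  by (cases A; cases B; cases C) (simp add: algebra_simps)

lemma coeff_hsubst_diag:
  "Polynomial.coeff (hsubst d (x, 0, 0, y) f) i = (if i \<le> d then x ^ (d - i) * y ^ i * Polynomial.coeff f i else 0)"
proof -
  have l: "[:x, 0:] ^ k = [:x ^ k:]" for k
    by (induction k) (simp_all add: ac_simps pCons_one)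
  have r: "[:0, y:] ^ k = Polynomial.monom (y ^ k) k" for k
  proof -
    have "[:0, y:] = Polynomial.monom y 1" by (simp add: monom_Suc monom_0)
    then show ?thesis by (simp add: monom_power)
  qed
  have "hsubst d (x, 0, 0, y) f = (\<Sum>j\<le>d. Polynomial.monom (x ^ (d - j) * y ^ j * Polynomial.coeff f j) j)"
    unfolding hsubst.simps l r by (intro sum.cong) (simp_all add: smult_monom ac_simps)
  also have "\<dots> = form_poly d (\<lambda>j. x ^ (d - j) * y ^ j * Polynomial.coeff f j)"
    by (simp add: form_poly_def)
  finally show ?thesis
    by (simp add: coeff_form_poly)
qed

lemma hsubst_scalar:
  assumes "Polynomial.degree p \<le> n"
  shows "hsubst n (c, 0, 0, c) p = Polynomial.smult (c ^ n) p"
  using assms by (intro poly_eqI) (auto simp: coeff_hsubst_diag coeff_eq_0 simp flip: power_add)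

text \<open>A version of \<open>conj_model\<close> on polynomials of a field type, where ordinary
  ring arithmetic applies; \<open>form_poly_conj_model\<close> translates between the two.\<close>

fun poly_conj :: "nat \<Rightarrow> 'a::comm_ring_1 matrix2 \<Rightarrow> 'a poly \<times> 'a poly \<Rightarrow> 'a poly \<times> 'a poly" where
  "poly_conj d (\<alpha>, \<beta>, \<gamma>, \<delta>) (f, g) =
     (Polynomial.smult \<delta> (hsubst d (\<alpha>, \<beta>, \<gamma>, \<delta>) f) - Polynomial.smult \<beta> (hsubst d (\<alpha>, \<beta>, \<gamma>, \<delta>) g),
      Polynomial.smult \<alpha> (hsubst d (\<alpha>, \<beta>, \<gamma>, \<delta>) g) - Polynomial.smult \<gamma> (hsubst d (\<alpha>, \<beta>, \<gamma>, \<delta>) f))"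

text \<open>A right action without correcting scalar, because the adjugate reverses
  products.\<close>

lemma poly_conj_mult:
  "poly_conj d \<Delta> (poly_conj d \<Gamma> fg) = poly_conj d (matrix2_mult \<Gamma> \<Delta>) fg"
proof -
  obtain \<alpha> \<beta> \<gamma> \<delta> where \<Gamma>: "\<Gamma> = (\<alpha>, \<beta>, \<gamma>, \<delta>)"
    by (cases \<Gamma>)
  obtain \<alpha>' \<beta>' \<gamma>' \<delta>' where \<Delta>: "\<Delta> = (\<alpha>', \<beta>', \<gamma>', \<delta>')"
    by (cases \<Delta>)
  obtain f g where fg: "fg = (f, g)" by (cases fg)
  note h = hsubst_hsubst[of d \<Delta> \<Gamma>, unfolded \<Delta> \<Gamma> matrix2_mult.simps]
  show ?thesis
    unfolding fg \<Gamma> \<Delta> poly_conj.simps matrix2_mult.simps hsubst_diff hsubst_smult h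
    by (auto intro!: poly_eqI simp: algebra_simps)
qed

lemma degree_poly_conj:
  "Polynomial.degree (fst (poly_conj d \<Gamma> fg)) \<le> d" "Polynomial.degree (snd (poly_conj d \<Gamma> fg)) \<le> d"
proof -
  obtain \<alpha> \<beta> \<gamma> \<delta> where \<Gamma>: "\<Gamma> = (\<alpha>, \<beta>, \<gamma>, \<delta>)"
    by (cases \<Gamma>)
  obtain f g where fg: "fg = (f, g)" by (cases fg)
  show "Polynomial.degree (fst (poly_conj d \<Gamma> fg)) \<le> d" "Polynomial.degree (snd (poly_conj d \<Gamma> fg)) \<le> d"
    unfolding \<Gamma> fg poly_conj.simps fst_conv snd_conv
    by (intro degree_diff_le order_trans[OF degree_smult_le] degree_hsubst)+
qed

lemma poly_conj_smult:
  "poly_conj d \<Gamma> (Polynomial.smult c f, Polynomial.smult c g) =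
    map_prod (Polynomial.smult c) (Polynomial.smult c) (poly_conj d \<Gamma> (f, g))"
  by (cases \<Gamma>) (simp add: hsubst_smult smult_diff_right ac_simps)

text \<open>Of the \<open>d + 1\<close> factors \<open>c\<close>, the substitution contributes
  \<open>d\<close> and the adjugate one.\<close>

lemma poly_conj_scalar:
  assumes "Polynomial.degree f \<le> d" "Polynomial.degree g \<le> d"
  shows "poly_conj d (c, 0, 0, c) (f, g) = (Polynomial.smult (c ^ Suc d) f, Polynomial.smult (c ^ Suc d) g)"
  using assms by (simp add: hsubst_scalar)

section \<open>Conjugation and ring homomorphisms\<close>

lemma base_field_simps [simp]:
  "carrier base_field = UNIV" "x \<otimes>\<^bsub>base_field\<^esub> y = x * y" "x \<oplus>\<^bsub>base_field\<^esub> y = x + y"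
  "\<one>\<^bsub>base_field\<^esub> = 1" "\<zero>\<^bsub>base_field\<^esub> = 0"
  by (simp_all add: ring_of_type_algebra_def)

lemma type_algebra_simps:
  "carrier ring_of_type_algebra = UNIV" "x \<otimes>\<^bsub>ring_of_type_algebra\<^esub> y = x * y"
  "x \<oplus>\<^bsub>ring_of_type_algebra\<^esub> y = x + y" "\<one>\<^bsub>ring_of_type_algebra\<^esub> = 1" "\<zero>\<^bsub>ring_of_type_algebra\<^esub> = 0"
  for x y :: "'a::comm_ring_1"
  by (simp_all add: ring_of_type_algebra_def)

lemma type_algebra_finsum:
  fixes f :: "'i \<Rightarrow> 'a::comm_ring_1"
  assumes "finite A"
  shows "finsum ring_of_type_algebra f A = sum f A"
proof -
  interpret cring "ring_of_type_algebra :: 'a ring" ..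
  show ?thesis
    using assms by induction (simp_all add: type_algebra_simps)
qed

lemma type_algebra_pow: "x [^]\<^bsub>ring_of_type_algebra\<^esub> (n::nat) = x ^ n"
  for x :: "'a::comm_ring_1"
proof -
  interpret cring "ring_of_type_algebra :: 'a ring" ..
  show ?thesis
    by (induction n) (simp_all add: type_algebra_simps ac_simps)
qed

lemma type_algebra_uminus: "\<ominus>\<^bsub>ring_of_type_algebra\<^esub> x = - x"
  for x :: "'a::comm_ring_1"
proof -
  interpret cring "ring_of_type_algebra :: 'a ring" ..
  show ?thesis
    by (rule minus_equality) (simp_all add: type_algebra_simps)
qed

lemma type_algebra_minus: "x \<ominus>\<^bsub>ring_of_type_algebra\<^esub> y = x - y"
  for x :: "'a::comm_ring_1"
  by (simp add: a_minus_def type_algebra_uminus type_algebra_simps)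

lemma type_algebra_Units: "Units ring_of_type_algebra = - {0 :: 'a::field}"
  by (auto simp: Units_def type_algebra_simps) (metis right_inverse left_inverse)

lemma UP_carrier: "carrier (UP R) = up R"
  and UP_coeff_apply: "p \<in> up R \<Longrightarrow> up_ring.coeff (UP R) p = p"
  and UP_monom_apply: "c \<in> carrier R \<Longrightarrow> up_ring.monom (UP R) c n = (\<lambda>i. if i = n then c else \<zero>\<^bsub>R\<^esub>)"
  and UP_smult_apply: "c \<in> carrier R \<Longrightarrow> p \<in> up R \<Longrightarrow> c \<odot>\<^bsub>UP R\<^esub> p = (\<lambda>i. c \<otimes>\<^bsub>R\<^esub> p i)"
  and UP_mult_apply: "p \<in> up R \<Longrightarrow> q \<in> up R \<Longrightarrow>
    p \<otimes>\<^bsub>UP R\<^esub> q = (\<lambda>n. \<Oplus>\<^bsub>R\<^esub>i\<in>{..n}. p i \<otimes>\<^bsub>R\<^esub> q (n - i))"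
  and UP_add_apply: "p \<in> up R \<Longrightarrow> q \<in> up R \<Longrightarrow> p \<oplus>\<^bsub>UP R\<^esub> q = (\<lambda>n. p n \<oplus>\<^bsub>R\<^esub> q n)"
  and UP_one_apply: "\<one>\<^bsub>UP R\<^esub> = (\<lambda>i. if i = 0 then \<one>\<^bsub>R\<^esub> else \<zero>\<^bsub>R\<^esub>)"
  by (auto simp: UP_def)

context ring_hom_cring

\<comment> \<open>Functoriality of conjugation in the coefficient ring\<close>
begin

lemma up_comp: "p \<in> up R \<Longrightarrow> (\<lambda>n. h (p n)) \<in> up S"
  by (fastforce simp: up_def bound_def)

lemma UP_hom: "ring_hom_cring (UP R) (UP S) (\<lambda>p n. h (p n))"
proof (rule ring_hom_cringI[OF UP_cring.UP_cring UP_cring.UP_cring])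
  show "UP_cring R" "UP_cring S"
    by (simp_all add: UP_cring_def R.is_cring S.is_cring)
  show "(\<lambda>p n. h (p n)) \<in> Ring.ring_hom (UP R) (UP S)"
  proof (rule ring_hom_memI)
    show "(\<lambda>n. h (p n)) \<in> carrier (UP S)" if "p \<in> carrier (UP R)" for p
      using that up_comp by (simp add: UP_carrier)
  next
    fix p q assume "p \<in> carrier (UP R)" "q \<in> carrier (UP R)"
    then have pq: "p \<in> up R" "q \<in> up R"
      by (simp_all add: UP_carrier)
    then have c: "p n \<in> carrier R" "q n \<in> carrier R" for n
      by auto
    have "h (\<Oplus>\<^bsub>R\<^esub>i\<in>{..n}. p i \<otimes>\<^bsub>R\<^esub> q (n - i)) = (\<Oplus>\<^bsub>S\<^esub>i\<in>{..n}. h (p i) \<otimes>\<^bsub>S\<^esub> h (q (n - i)))" for n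
      using c by (subst hom_finsum) (auto intro!: S.finsum_cong' simp: o_def)
    then show "(\<lambda>n. h ((p \<otimes>\<^bsub>UP R\<^esub> q) n)) = (\<lambda>n. h (p n)) \<otimes>\<^bsub>UP S\<^esub> (\<lambda>n. h (q n))"
      using pq up_comp by (simp add: UP_mult_apply)
    show "(\<lambda>n. h ((p \<oplus>\<^bsub>UP R\<^esub> q) n)) = (\<lambda>n. h (p n)) \<oplus>\<^bsub>UP S\<^esub> (\<lambda>n. h (q n))"
      using pq up_comp c by (simp add: UP_add_apply)
  next
    show "(\<lambda>n. h (\<one>\<^bsub>UP R\<^esub> n)) = \<one>\<^bsub>UP S\<^esub>"
      by (auto simp: UP_one_apply)
  qed
qed

text \<open>The substituted form is built by ring operations in the univariate polynomial ring, so
  the coefficientwise homomorphism \<open>UP_hom\<close> commutes with each of them.\<close>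

lemma form_subst_hom:
  assumes "{\<alpha>, \<beta>, \<gamma>, \<delta>} \<subseteq> carrier R" "\<And>i. i \<le> d \<Longrightarrow> a i \<in> carrier R"
  shows "form_subst S d (h \<alpha>, h \<beta>, h \<gamma>, h \<delta>) (\<lambda>i. h (a i)) k =
      h (form_subst R d (\<alpha>, \<beta>, \<gamma>, \<delta>) a k)"
    and "form_subst R d (\<alpha>, \<beta>, \<gamma>, \<delta>) a k \<in> carrier R"
proof -
  interpret R: UP_cring R "UP R" by unfold_locales
  interpret S: UP_cring S "UP S" by unfold_locales
  interpret H: ring_hom_cring "UP R" "UP S" "\<lambda>p n. h (p n)" by (rule UP_hom)
  have mon: "(\<lambda>n. h (up_ring.monom (UP R) c m n)) = up_ring.monom (UP S) (h c) m"
    if "c \<in> carrier R" for c m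
    using that by (auto simp: UP_monom_apply)
  have smult: "(\<lambda>n. h ((c \<odot>\<^bsub>UP R\<^esub> p) n)) = h c \<odot>\<^bsub>UP S\<^esub> (\<lambda>n. h (p n))"
    if "c \<in> carrier R" "p \<in> carrier (UP R)" for c p
  proof -
    have p: "p \<in> up R" using that(2) by (simp add: UP_carrier)
    then have "p n \<in> carrier R" for n by auto
    then show ?thesis
      using that(1) p up_comp[OF p] by (simp add: UP_smult_apply)
  qed
  define L where "L x y = up_ring.monom (UP R) x 0 \<oplus>\<^bsub>UP R\<^esub> up_ring.monom (UP R) y 1" for x y
  have Lc [simp]: "L x y \<in> carrier (UP R)" if "x \<in> carrier R" "y \<in> carrier R" for x y
    using that by (simp add: L_def)
  have HL: "(\<lambda>n. h (L x y n)) = up_ring.monom (UP S) (h x) 0 \<oplus>\<^bsub>UP S\<^esub> up_ring.monom (UP S) (h y) 1"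
    if "x \<in> carrier R" "y \<in> carrier R" for x y
    using that by (simp add: L_def H.hom_add mon[symmetric])
  define T where "T i = L \<alpha> \<beta> [^]\<^bsub>UP R\<^esub> (d - i) \<otimes>\<^bsub>UP R\<^esub> L \<gamma> \<delta> [^]\<^bsub>UP R\<^esub> i" for i
  have Tc [simp]: "T i \<in> carrier (UP R)" for i
    using assms(1) by (simp add: T_def)
  define P where "P = (\<Oplus>\<^bsub>UP R\<^esub>i\<in>{..d}. a i \<odot>\<^bsub>UP R\<^esub> T i)"
  have Pc: "P \<in> carrier (UP R)"
    unfolding P_def using assms(2) by (intro R.P.finsum_closed) auto
  have "(\<lambda>n. h (P n)) = (\<Oplus>\<^bsub>UP S\<^esub>i\<in>{..d}. h (a i) \<odot>\<^bsub>UP S\<^esub> (\<lambda>n. h (T i n)))"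
    unfolding P_def using assms(2)
    by (subst H.hom_finsum) (auto intro!: S.P.finsum_cong' H.hom_closed simp: o_def smult)
  also have "\<dots> = (\<Oplus>\<^bsub>UP S\<^esub> i\<in>{..d}. h (a i) \<odot>\<^bsub>UP S\<^esub>
        ((up_ring.monom (UP S) (h \<alpha>) 0 \<oplus>\<^bsub>UP S\<^esub> up_ring.monom (UP S) (h \<beta>) 1) [^]\<^bsub>UP S\<^esub> (d - i)
         \<otimes>\<^bsub>UP S\<^esub>
         (up_ring.monom (UP S) (h \<gamma>) 0 \<oplus>\<^bsub>UP S\<^esub> up_ring.monom (UP S) (h \<delta>) 1) [^]\<^bsub>UP S\<^esub> i))"
    using assms(1) by (simp add: T_def H.hom_mult H.hom_pow HL)
  finally have eq: "(\<lambda>n. h (P n)) = \<dots>" .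
  have P: "form_subst R d (\<alpha>, \<beta>, \<gamma>, \<delta>) a k = P k"
    using Pc by (simp add: P_def T_def L_def UP_carrier UP_coeff_apply)
  show "form_subst R d (\<alpha>, \<beta>, \<gamma>, \<delta>) a k \<in> carrier R"
    unfolding P using Pc by (auto simp: UP_carrier)
  have "form_subst S d (h \<alpha>, h \<beta>, h \<gamma>, h \<delta>) (\<lambda>i. h (a i)) k = h (P k)"
    unfolding form_subst.simps eq[symmetric]
    using H.hom_closed[OF Pc] by (simp add: UP_carrier UP_coeff_apply)
  then show "form_subst S d (h \<alpha>, h \<beta>, h \<gamma>, h \<delta>) (\<lambda>i. h (a i)) k =
      h (form_subst R d (\<alpha>, \<beta>, \<gamma>, \<delta>) a k)"
    unfolding P .
qed

text \<open>Needed for two maps out of a local ring: the inclusion into the field and the reduction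
  to the algebraic closure of the residue field.\<close>

lemma conj_model_hom:
  assumes "{\<alpha>, \<beta>, \<gamma>, \<delta>} \<subseteq> carrier R"
    and "\<And>i. i \<le> d \<Longrightarrow> a i \<in> carrier R" "\<And>i. i \<le> d \<Longrightarrow> b i \<in> carrier R"
  shows "conj_model S d (h \<alpha>, h \<beta>, h \<gamma>, h \<delta>) (\<lambda>i. h (a i), \<lambda>i. h (b i)) =
      map_prod (\<lambda>a' i. h (a' i)) (\<lambda>b' i. h (b' i)) (conj_model R d (\<alpha>, \<beta>, \<gamma>, \<delta>) (a, b))"
    and "fst (conj_model R d (\<alpha>, \<beta>, \<gamma>, \<delta>) (a, b)) i \<in> carrier R"
    and "snd (conj_model R d (\<alpha>, \<beta>, \<gamma>, \<delta>) (a, b)) i \<in> carrier R"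
  using assms(1)
  by (simp_all add: Let_def form_subst_hom[OF assms(1,2)] form_subst_hom[OF assms(1,3)] a_minus_def
      del: form_subst.simps)

end

section \<open>Polynomials of the field type versus the polynomial ring used in
  \<open>form_subst\<close>\<close>

lemma coeff_in_up: "Polynomial.coeff p \<in> up base_field"
  by (auto simp: up_def bound_def intro!: exI[of _ "Polynomial.degree p"] coeff_eq_0)

lemma UP_cring_base_field: "UP_cring base_field"
  by (simp add: UP_cring_def cring_from_type_algebra)

lemma coeff_hom:
  "ring_hom_cring (ring_of_type_algebra :: 'k::field_char_0 poly ring) (UP base_field) Polynomial.coeff"
proof (rule ring_hom_cringI[OF cring_from_type_algebra UP_cring.UP_cring[OF UP_cring_base_field]])
  show "Polynomial.coeff \<in> Ring.ring_hom (ring_of_type_algebra :: 'k poly ring) (UP base_field)"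
  proof (rule ring_hom_memI)
    fix p q :: "'k poly"
    show "Polynomial.coeff p \<in> carrier (UP base_field)"
      by (simp add: UP_carrier coeff_in_up)
    show "Polynomial.coeff (p \<otimes>\<^bsub>ring_of_type_algebra\<^esub> q) =
        Polynomial.coeff p \<otimes>\<^bsub>UP base_field\<^esub> Polynomial.coeff q"
      by (rule ext) (simp add: coeff_in_up UP_mult_apply type_algebra_simps coeff_mult type_algebra_finsum)
    show "Polynomial.coeff (p \<oplus>\<^bsub>ring_of_type_algebra\<^esub> q) =
        Polynomial.coeff p \<oplus>\<^bsub>UP base_field\<^esub> Polynomial.coeff q"
      by (rule ext) (simp add: coeff_in_up UP_add_apply type_algebra_simps)
  next
    show "Polynomial.coeff \<one>\<^bsub>ring_of_type_algebra\<^esub> = \<one>\<^bsub>UP base_field :: (_, nat \<Rightarrow> 'k) up_ring\<^esub>"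
      by (auto simp: UP_one_apply type_algebra_simps)
  qed
qed

lemma form_subst_base_field:
  "form_subst base_field d \<Gamma> a = Polynomial.coeff (hsubst d \<Gamma> (form_poly d a))"
proof -
  obtain \<alpha> \<beta> \<gamma> \<delta> where \<Gamma>: "\<Gamma> = (\<alpha>, \<beta>, \<gamma>, \<delta>)"
    by (cases \<Gamma>)
  interpret H: ring_hom_cring "ring_of_type_algebra :: 'a poly ring" "UP base_field" Polynomial.coeff
    by (rule coeff_hom)
  note coeff = UP_coeff_apply[OF coeff_in_up]
  have lin: "Polynomial.coeff [:x, y:] =
      up_ring.monom (UP base_field) x 0 \<oplus>\<^bsub>UP base_field\<^esub> up_ring.monom (UP base_field) y 1" for x y :: 'a
  proof -
    have m: "up_ring.monom (UP base_field) c n = Polynomial.coeff (Polynomial.monom c n)" for c :: 'a and n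
      by (auto simp: UP_monom_apply)
    show ?thesis
      using H.hom_add[of "Polynomial.monom x 0" "Polynomial.monom y 1"]
      unfolding m by (simp add: type_algebra_simps monom_0 monom_Suc)
  qed
  have smult: "Polynomial.coeff (Polynomial.smult c p) = c \<odot>\<^bsub>UP base_field\<^esub> Polynomial.coeff p"
    for c :: 'a and p
    by (rule ext) (simp add: UP_smult_apply coeff_in_up)
  have pow: "Polynomial.coeff (p ^ n) = Polynomial.coeff p [^]\<^bsub>UP base_field\<^esub> n" for p :: "'a poly" and n
    using H.hom_pow[of p n] by (simp add: type_algebra_simps type_algebra_pow)
  have mult: "Polynomial.coeff (p * q) = Polynomial.coeff p \<otimes>\<^bsub>UP base_field\<^esub> Polynomial.coeff q" for p q :: "'a poly"
    using H.hom_mult[of p q] by (simp add: type_algebra_simps)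
  have sum: "Polynomial.coeff (sum f {..d}) = (\<Oplus>\<^bsub>UP base_field\<^esub> i\<in>{..d}. Polynomial.coeff (f i))"
    for f :: "nat \<Rightarrow> 'a poly"
    using H.hom_finsum[of f "{..d}"] by (simp add: type_algebra_simps type_algebra_finsum o_def)
  have "hsubst d \<Gamma> (form_poly d a) =
      (\<Sum>i\<le>d. Polynomial.smult (a i) ([:\<alpha>, \<beta>:] ^ (d - i) * [:\<gamma>, \<delta>:] ^ i))"
    unfolding \<Gamma> hsubst.simps by (intro sum.cong) (auto simp: coeff_form_poly)
  then show ?thesis
    unfolding \<Gamma> form_subst.simps by (simp only: coeff flip: sum smult mult pow lin)
qed

lemma conj_model_base_field:
  "conj_model base_field d \<Gamma> (a, b) =
    map_prod Polynomial.coeff Polynomial.coeff (poly_conj d \<Gamma> (form_poly d a, form_poly d b))"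
  by (cases \<Gamma>) (auto simp: Let_def form_subst_base_field type_algebra_minus type_algebra_uminus
      simp del: form_subst.simps)

lemma form_poly_conj_model:
  "(form_poly d (fst (conj_model base_field d \<Gamma> (a, b))), form_poly d (snd (conj_model base_field d \<Gamma> (a, b))))
    = poly_conj d \<Gamma> (form_poly d a, form_poly d b)"
  by (simp add: conj_model_base_field form_poly_coeff degree_poly_conj)

section \<open>Resultants over a subring\<close>

text \<open>Bare closure conditions on a set serve both a local ring and, with \<open>UNIV\<close>
  for \<open>S\<close>, the field itself.\<close>

locale subring_of_field =
  fixes S :: "'k::field_char_0 set"
  assumes zero_mem [simp]: "0 \<in> S" and one_mem [simp]: "1 \<in> S"
    and add_mem [simp]: "\<And>x y. x \<in> S \<Longrightarrow> y \<in> S \<Longrightarrow> x + y \<in> S"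
    and mult_mem [simp]: "\<And>x y. x \<in> S \<Longrightarrow> y \<in> S \<Longrightarrow> x * y \<in> S"
    and uminus_mem [simp]: "\<And>x. x \<in> S \<Longrightarrow> - x \<in> S"
begin

lemma diff_mem [simp]: "x \<in> S \<Longrightarrow> y \<in> S \<Longrightarrow> x - y \<in> S"
  using add_mem[of x "- y"] by simp

lemma power_mem [simp]: "x \<in> S \<Longrightarrow> x ^ n \<in> S"
  by (induction n) simp_all

lemma sum_mem: "(\<And>i. i \<in> A \<Longrightarrow> f i \<in> S) \<Longrightarrow> sum f A \<in> S"
  by (induction A rule: infinite_finite_induct) simp_all

lemma prod_mem: "(\<And>i. i \<in> A \<Longrightarrow> f i \<in> S) \<Longrightarrow> prod f A \<in> S"
  by (induction A rule: infinite_finite_induct) simp_all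

lemma det_mem:
  assumes "A \<in> carrier_mat n n" "\<And>i j. i < n \<Longrightarrow> j < n \<Longrightarrow> A $$ (i, j) \<in> S"
  shows "det A \<in> S"
proof -
  have "signof p \<in> S" for p :: "nat \<Rightarrow> nat"
    by (simp add: sign_def)
  moreover have "A $$ (i, p i) \<in> S" if "p permutes {0..<n}" "i \<in> {0..<n}" for p i
    using that assms(2) permutes_in_image by fastforce
  ultimately show ?thesis
    unfolding det_def'[OF assms(1)] by (intro sum_mem mult_mem prod_mem) auto
qed

definition polys_over :: "'k poly set" where
  "polys_over = {p. \<forall>i. Polynomial.coeff p i \<in> S}"

lemma polys_over_0 [simp]: "0 \<in> polys_over"
  and polys_over_1 [simp]: "1 \<in> polys_over"
  and polys_over_add: "p \<in> polys_over \<Longrightarrow> q \<in> polys_over \<Longrightarrow> p + q \<in> polys_over"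
  and polys_over_diff: "p \<in> polys_over \<Longrightarrow> q \<in> polys_over \<Longrightarrow> p - q \<in> polys_over"
  and polys_over_mult: "p \<in> polys_over \<Longrightarrow> q \<in> polys_over \<Longrightarrow> p * q \<in> polys_over"
  and polys_over_smult: "c \<in> S \<Longrightarrow> p \<in> polys_over \<Longrightarrow> Polynomial.smult c p \<in> polys_over"
  and polys_over_monom: "c \<in> S \<Longrightarrow> Polynomial.monom c i \<in> polys_over"
  by (auto simp: polys_over_def coeff_mult intro!: sum_mem)

lemma polys_over_sum: "(\<And>i. i \<in> A \<Longrightarrow> f i \<in> polys_over) \<Longrightarrow> sum f A \<in> polys_over"
  by (induction A rule: infinite_finite_induct) (simp_all add: polys_over_add)

lemma polys_over_power: "p \<in> polys_over \<Longrightarrow> p ^ n \<in> polys_over"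
  by (induction n) (simp_all add: polys_over_mult)

lemma polys_over_linear: "a \<in> S \<Longrightarrow> b \<in> S \<Longrightarrow> [:a, b:] \<in> polys_over"
  by (auto simp: polys_over_def coeff_pCons split: nat.split)

lemma polys_over_form_poly: "(\<And>i. i \<le> d \<Longrightarrow> a i \<in> S) \<Longrightarrow> form_poly d a \<in> polys_over"
  by (auto simp: polys_over_def coeff_form_poly)

lemma polys_over_hsubst:
  assumes "{\<alpha>, \<beta>, \<gamma>, \<delta>} \<subseteq> S" "p \<in> polys_over"
  shows "hsubst n (\<alpha>, \<beta>, \<gamma>, \<delta>) p \<in> polys_over"
  unfolding hsubst.simps using assms
  by (intro polys_over_sum polys_over_smult polys_over_mult polys_over_power polys_over_linear)
    (auto simp: polys_over_def)

lemma polys_over_poly_conj: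
  assumes "{\<alpha>, \<beta>, \<gamma>, \<delta>} \<subseteq> S" "f \<in> polys_over" "g \<in> polys_over"
  shows "fst (poly_conj d (\<alpha>, \<beta>, \<gamma>, \<delta>) (f, g)) \<in> polys_over"
    and "snd (poly_conj d (\<alpha>, \<beta>, \<gamma>, \<delta>) (f, g)) \<in> polys_over"
  using assms by (auto intro!: polys_over_diff polys_over_smult polys_over_hsubst)

text \<open>
  Over \<open>S\<close>, a unit resultant amounts to the forms of degree \<open>2d - 1\<close> being spanned by multiples of
  the two forms of degree \<open>d\<close>. Unlike the determinant, this is visibly invariant under
  linear substitutions that are invertible over \<open>S\<close>.
\<close>

definition spanning :: "nat \<Rightarrow> 'k poly \<Rightarrow> 'k poly \<Rightarrow> bool" where
  "spanning d f g \<longleftrightarrow> (\<forall>h\<in>polys_over. Polynomial.degree h < 2 * d \<longrightarrow>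
     (\<exists>u\<in>polys_over. \<exists>v\<in>polys_over. Polynomial.degree u < d \<and> Polynomial.degree v < d \<and>
        h = u * f + v * g))"

text \<open>Pull \<open>h\<close> back by the inverse matrix, write the result as a combination of
  \<open>f\<close> and \<open>g\<close>, and substitute forward again. This expresses
  \<open>h\<close> through the substituted forms; it remains to absorb the adjugate into the
  cofactors.\<close>

lemma spanning_poly_conj:
  assumes "0 < d" and \<Gamma>: "{\<alpha>, \<beta>, \<gamma>, \<delta>} \<subseteq> S"
    and D: "\<alpha> * \<delta> - \<beta> * \<gamma> \<noteq> 0" "inverse (\<alpha> * \<delta> - \<beta> * \<gamma>) \<in> S"
    and deg: "Polynomial.degree f \<le> d" "Polynomial.degree g \<le> d"
    and span: "spanning d f g"
  shows "spanning d (fst (poly_conj d (\<alpha>, \<beta>, \<gamma>, \<delta>) (f, g))) (snd (poly_conj d (\<alpha>, \<beta>, \<gamma>, \<delta>) (f, g)))"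
  unfolding spanning_def
proof (intro ballI impI)
  fix h assume h: "h \<in> polys_over" "Polynomial.degree h < 2 * d"
  define e where "e = inverse (\<alpha> * \<delta> - \<beta> * \<gamma>)"
  have e: "e * (\<alpha> * \<delta> - \<beta> * \<gamma>) = 1" "e \<in> S"
    using D by (simp_all add: e_def)
  define \<Gamma>' where "\<Gamma>' = (e * \<delta>, - e * \<beta>, - e * \<gamma>, e * \<alpha>)"
  have inv: "matrix2_mult \<Gamma>' (\<alpha>, \<beta>, \<gamma>, \<delta>) = (1, 0, 0, 1)"
    using e(1) by (simp add: \<Gamma>'_def algebra_simps)
  have "hsubst (2 * d - 1) \<Gamma>' h \<in> polys_over"
    unfolding \<Gamma>'_def using e(2) \<Gamma> h(1) by (intro polys_over_hsubst) auto
  moreover have "Polynomial.degree (hsubst (2 * d - 1) \<Gamma>' h) < 2 * d"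
    using degree_hsubst[of "2 * d - 1" \<Gamma>' h] \<open>0 < d\<close> by linarith
  ultimately obtain u v where uv: "u \<in> polys_over" "v \<in> polys_over"
      "Polynomial.degree u < d" "Polynomial.degree v < d" "hsubst (2 * d - 1) \<Gamma>' h = u * f + v * g"
    using span unfolding spanning_def by blast
  define U where "U = hsubst (d - 1) (\<alpha>, \<beta>, \<gamma>, \<delta>) u"
  define V where "V = hsubst (d - 1) (\<alpha>, \<beta>, \<gamma>, \<delta>) v"
  define F where "F = hsubst d (\<alpha>, \<beta>, \<gamma>, \<delta>) f"
  define G where "G = hsubst d (\<alpha>, \<beta>, \<gamma>, \<delta>) g"
  have n: "2 * d - 1 = (d - 1) + d"
    using \<open>0 < d\<close> by simp
  have "h = hsubst (2 * d - 1) (\<alpha>, \<beta>, \<gamma>, \<delta>) (hsubst (2 * d - 1) \<Gamma>' h)"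
    unfolding hsubst_hsubst inv using hsubst_scalar[of h "2 * d - 1" 1] h(2) by simp
  also have "\<dots> = U * F + V * G"
    unfolding uv(5) unfolding hsubst_add n U_def V_def F_def G_def using uv(3,4) deg
    by (subst (1 2) hsubst_mult) auto
  finally have hUV: "h = U * F + V * G" .
  \<comment> \<open>The row vector (U, V) times the matrix, divided by its determinant: a matrix
    times its adjugate is the determinant, so the adjugate in the conjugated forms cancels.\<close>
  define U' where "U' = Polynomial.smult e (Polynomial.smult \<alpha> U + Polynomial.smult \<gamma> V)"
  define V' where "V' = Polynomial.smult e (Polynomial.smult \<beta> U + Polynomial.smult \<delta> V)"
  have UV: "U \<in> polys_over" "V \<in> polys_over"
    unfolding U_def V_def using uv \<Gamma> by (auto intro!: polys_over_hsubst)
  have dUV: "Polynomial.degree U \<le> d - 1" "Polynomial.degree V \<le> d - 1"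
    unfolding U_def V_def by (rule degree_hsubst)+
  have "U' * (Polynomial.smult \<delta> F - Polynomial.smult \<beta> G) + V' * (Polynomial.smult \<alpha> G - Polynomial.smult \<gamma> F)
      = Polynomial.smult (e * (\<alpha> * \<delta> - \<beta> * \<gamma>)) (U * F + V * G)"
    by (simp add: U'_def V'_def algebra_simps smult_add_left smult_add_right smult_diff_left smult_diff_right)
  then have "h = U' * (Polynomial.smult \<delta> F - Polynomial.smult \<beta> G) + V' * (Polynomial.smult \<alpha> G - Polynomial.smult \<gamma> F)"
    using e(1) hUV by simp
  moreover have "U' \<in> polys_over" "V' \<in> polys_over"
    unfolding U'_def V'_def using UV \<Gamma> e(2) by (auto intro!: polys_over_smult polys_over_add)
  moreover have "Polynomial.degree U' \<le> d - 1" "Polynomial.degree V' \<le> d - 1"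
    unfolding U'_def V'_def using dUV
    by (auto intro!: order_trans[OF degree_smult_le] degree_add_le)
  ultimately show "\<exists>u\<in>polys_over. \<exists>v\<in>polys_over. Polynomial.degree u < d \<and> Polynomial.degree v < d \<and>
      h = u * fst (poly_conj d (\<alpha>, \<beta>, \<gamma>, \<delta>) (f, g)) + v * snd (poly_conj d (\<alpha>, \<beta>, \<gamma>, \<delta>) (f, g))"
    using \<open>0 < d\<close> by (intro bexI[of _ U'] bexI[of _ V']) (auto simp: F_def G_def)
qed

end

section \<open>The Sylvester matrix as a map on pairs of cofactors\<close>

definition model_sylvester :: "nat \<Rightarrow> 'k::field_char_0 form \<Rightarrow> 'k form \<Rightarrow> 'k mat" where
  "model_sylvester d a b = sylvester_mat_sub d d (dehomogenize d a) (dehomogenize d b)"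

lemma form_resultant_eq: "form_resultant d (a, b) = det (model_sylvester d a b)"
  by (simp add: model_sylvester_def)

lemma model_sylvester_carrier: "model_sylvester d a b \<in> carrier_mat (2 * d) (2 * d)"
  using sylvester_mat_sub_carrier[of d d] by (simp add: model_sylvester_def mult_2)

lemma coeff_dehomogenize: "Polynomial.coeff (dehomogenize d a) k = (if k \<le> d then a (d - k) else 0)"
proof -
  have "Polynomial.coeff (dehomogenize d a) k = (\<Sum>i\<le>d. if i = d - k \<and> k \<le> d then a i else 0)"
    unfolding dehomogenize_def coeff_sum by (intro sum.cong) auto
  also have "\<dots> = (if k \<le> d then a (d - k) else 0)"
    by simp
  finally show ?thesis .
qed

text \<open>
  The rows of the Sylvester matrix are the forms \<open>X\<^sup>d\<^sup>-\<^sup>1\<^sup>-\<^sup>iY\<^sup>iF\<^sub>a\<close> and \<open>X\<^sup>d\<^sup>-\<^sup>1\<^sup>-\<^sup>iY\<^sup>iF\<^sub>b\<close>, the column index being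
  the exponent of \<open>Y\<close>.
\<close>

lemma model_sylvester_index:
  assumes "i < 2 * d" "j < 2 * d"
  shows "model_sylvester d a b $$ (i, j) = Polynomial.coeff
    (if i < d then Polynomial.monom 1 i * form_poly d a else Polynomial.monom 1 (i - d) * form_poly d b) j"
  using assms unfolding model_sylvester_def
  by (subst sylvester_mat_sub_index) (auto simp: coeff_monom_mult coeff_form_poly coeff_dehomogenize add.commute)

text \<open>Reads a row vector of length \<open>2 * d\<close> as two cofactors of degree below
  \<open>d\<close>; multiplying the vector by the Sylvester matrix then yields the coefficients of
  the combination of the two forms.\<close>

definition pair_poly :: "nat \<Rightarrow> (nat \<Rightarrow> 'k::comm_ring_1) \<Rightarrow> 'k poly \<times> 'k poly" where
  "pair_poly d w = (\<Sum>i<d. Polynomial.monom (w i) i, \<Sum>i<d. Polynomial.monom (w (d + i)) i)"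

lemma degree_pair_poly:
  assumes "0 < d"
  shows "Polynomial.degree (fst (pair_poly d w)) < d" "Polynomial.degree (snd (pair_poly d w)) < d"
proof -
  have "Polynomial.degree (\<Sum>i<d. Polynomial.monom (c i) i) < d" for c :: "nat \<Rightarrow> 'a"
  proof -
    have "Polynomial.degree (\<Sum>i<d. Polynomial.monom (c i) i) \<le> d - 1"
      by (rule degree_sum_le) (auto intro: order_trans[OF degree_monom_le])
    then show ?thesis
      using assms by linarith
  qed
  then show "Polynomial.degree (fst (pair_poly d w)) < d" "Polynomial.degree (snd (pair_poly d w)) < d"
    by (simp_all add: pair_poly_def)
qed

lemma coeff_pair_poly:
  "i < d \<Longrightarrow> Polynomial.coeff (fst (pair_poly d w)) i = w i"
  "i < d \<Longrightarrow> Polynomial.coeff (snd (pair_poly d w)) i = w (d + i)"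
  by (simp_all add: pair_poly_def coeff_sum)

lemma pair_poly_mult_sylvester:
  assumes "j < 2 * d"
  shows "(\<Sum>i<2*d. w i * model_sylvester d a b $$ (i, j)) =
    Polynomial.coeff (fst (pair_poly d w) * form_poly d a + snd (pair_poly d w) * form_poly d b) j"
proof -
  have split: "(\<Sum>i<m+n. f i) = (\<Sum>i<m. f i) + (\<Sum>i<n. f (m + i))" for f :: "nat \<Rightarrow> 'a" and m n
    by (induction n) (simp_all add: ac_simps)
  have "(\<Sum>i<2*d. w i * model_sylvester d a b $$ (i, j)) =
      (\<Sum>i<d. w i * model_sylvester d a b $$ (i, j)) + (\<Sum>i<d. w (d + i) * model_sylvester d a b $$ (d + i, j))"
    unfolding mult_2 by (rule split)
  also have "(\<Sum>i<d. w i * model_sylvester d a b $$ (i, j)) =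
      Polynomial.coeff (fst (pair_poly d w) * form_poly d a) j"
    using assms unfolding pair_poly_def fst_conv sum_distrib_right coeff_sum
    by (intro sum.cong) (auto simp: model_sylvester_index coeff_monom_mult)
  also have "(\<Sum>i<d. w (d + i) * model_sylvester d a b $$ (d + i, j)) =
      Polynomial.coeff (snd (pair_poly d w) * form_poly d b) j"
    using assms unfolding pair_poly_def snd_conv sum_distrib_right coeff_sum
    by (intro sum.cong) (auto simp: model_sylvester_index coeff_monom_mult)
  finally show ?thesis by simp
qed

lemma pair_poly_of_polys:
  assumes "Polynomial.degree u < d" "Polynomial.degree v < d"
  shows "pair_poly d (\<lambda>i. if i < d then Polynomial.coeff u i else Polynomial.coeff v (i - d)) = (u, v)"
proof -
  have "(\<Sum>i<d. Polynomial.monom (Polynomial.coeff p i) i) = p" if "Polynomial.degree p < d" for p :: "'a poly"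
    using poly_as_sum_of_monoms'[of p "d - 1"] that by (cases d) (auto simp: lessThan_Suc_atMost)
  then show ?thesis
    using assms by (simp add: pair_poly_def)
qed

context subring_of_field
begin

lemma form_resultant_mem:
  assumes "\<And>i. i \<le> d \<Longrightarrow> a i \<in> S" "\<And>i. i \<le> d \<Longrightarrow> b i \<in> S"
  shows "form_resultant d (a, b) \<in> S"
  unfolding form_resultant_eq using assms
  by (intro det_mem[OF model_sylvester_carrier]) (auto simp: model_sylvester_index coeff_monom_mult coeff_form_poly)

text \<open>The cofactors that produce the monomials Y^k, for \<open>k < 2 * d\<close>, are the rows
  of a left inverse of the Sylvester matrix with entries in \<open>S\<close>. Taking determinants
  exhibits the inverse of the resultant in \<open>S\<close>.\<close>

lemma spanning_imp_unit_resultant: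
  assumes "spanning d (form_poly d a) (form_poly d b)"
  shows "form_resultant d (a, b) \<noteq> 0 \<and> inverse (form_resultant d (a, b)) \<in> S"
proof -
  let ?M = "model_sylvester d a b"
  have "\<forall>k\<in>{..<2*d}. \<exists>w. (\<forall>i. w i \<in> S) \<and>
      Polynomial.monom 1 k = fst (pair_poly d w) * form_poly d a + snd (pair_poly d w) * form_poly d b"
  proof
    fix k assume "k \<in> {..<2*d}"
    then have "Polynomial.degree (Polynomial.monom (1::'k) k) < 2 * d"
      by (auto simp: degree_monom_eq)
    then obtain u v where uv: "u \<in> polys_over" "v \<in> polys_over" "Polynomial.degree u < d" "Polynomial.degree v < d"
      "Polynomial.monom 1 k = u * form_poly d a + v * form_poly d b"
      using assms polys_over_monom[of 1 k] unfolding spanning_def by (metis one_mem)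
    define w where "w i = (if i < d then Polynomial.coeff u i else Polynomial.coeff v (i - d))" for i
    have "\<forall>i. w i \<in> S"
      using uv(1,2) by (auto simp: w_def polys_over_def)
    moreover have "pair_poly d w = (u, v)"
      unfolding w_def using uv by (intro pair_poly_of_polys) auto
    ultimately show "\<exists>w. (\<forall>i. w i \<in> S) \<and>
      Polynomial.monom 1 k = fst (pair_poly d w) * form_poly d a + snd (pair_poly d w) * form_poly d b"
      using uv(5) by (intro exI[of _ w]) auto
  qed
  then obtain W where W: "\<And>k i. k < 2 * d \<Longrightarrow> W k i \<in> S"
    "\<And>k. k < 2 * d \<Longrightarrow> Polynomial.monom 1 k =
      fst (pair_poly d (W k)) * form_poly d a + snd (pair_poly d (W k)) * form_poly d b"
    by (metis lessThan_iff)
  define B where "B = mat (2*d) (2*d) (\<lambda>(k, i). W k i)"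
  have B: "B \<in> carrier_mat (2*d) (2*d)"
    by (simp add: B_def)
  have "B * ?M = 1\<^sub>m (2 * d)"
  proof (rule eq_matI)
    fix k j assume "k < dim_row (1\<^sub>m (2*d))" "j < dim_col (1\<^sub>m (2*d))"
    then have kj: "k < 2 * d" "j < 2 * d" by auto
    have "(B * ?M) $$ (k, j) = (\<Sum>i<2*d. W k i * ?M $$ (i, j))"
      using kj model_sylvester_carrier[of d a b]
      by (simp add: B_def scalar_prod_def atLeast0LessThan)
    also have "\<dots> = Polynomial.coeff (Polynomial.monom 1 k) j"
      unfolding pair_poly_mult_sylvester[OF kj(2)] W(2)[OF kj(1), symmetric] ..
    finally show "(B * ?M) $$ (k, j) = 1\<^sub>m (2*d) $$ (k, j)"
      using kj by simp
  qed (use B model_sylvester_carrier[of d a b] in auto)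
  then have "det B * det ?M = 1"
    using det_mult[OF B model_sylvester_carrier[of d a b]] by simp
  moreover have "det B \<in> S"
    using W(1) by (intro det_mem[OF B]) (simp add: B_def)
  ultimately show ?thesis
    unfolding form_resultant_eq by (metis inverse_unique mult.commute mult_zero_right zero_neq_one)
qed

text \<open>Cramer's rule: the adjugate of the Sylvester matrix has entries in \<open>S\<close>, and
  dividing by the unit determinant stays in \<open>S\<close>.\<close>

lemma unit_resultant_imp_spanning:
  assumes "0 < d" and ab: "\<And>i. i \<le> d \<Longrightarrow> a i \<in> S" "\<And>i. i \<le> d \<Longrightarrow> b i \<in> S"
    and unit: "form_resultant d (a, b) \<noteq> 0" "inverse (form_resultant d (a, b)) \<in> S"
  shows "spanning d (form_poly d a) (form_poly d b)"
  unfolding spanning_def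
proof (intro ballI impI)
  fix h assume h: "h \<in> polys_over" "Polynomial.degree h < 2 * d"
  let ?M = "model_sylvester d a b"
  let ?A = "adj_mat ?M"
  define e where "e = inverse (det ?M)"
  have e: "e * det ?M = 1" "e \<in> S"
    using unit by (simp_all add: e_def model_sylvester_def)
  note M = model_sylvester_carrier[of d a b]
  have A: "?A \<in> carrier_mat (2*d) (2*d)" and AM: "?A * ?M = det ?M \<cdot>\<^sub>m 1\<^sub>m (2*d)"
    using adj_mat[OF M] by auto
  have entries: "?M $$ (i, j) \<in> S" if "i < 2*d" "j < 2*d" for i j
    using that ab by (auto simp: model_sylvester_index coeff_monom_mult coeff_form_poly)
  have A_mem: "?A $$ (i, j) \<in> S" if "i < 2*d" "j < 2*d" for i j
  proof -
    have "mat_delete ?M j i \<in> carrier_mat (2*d - 1) (2*d - 1)"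
      using M by (simp add: mat_delete_def)
    moreover have "mat_delete ?M j i $$ (i', j') \<in> S" if "i' < 2*d - 1" "j' < 2*d - 1" for i' j'
      using that M \<open>i < 2*d\<close> \<open>j < 2*d\<close> by (auto simp: mat_delete_def intro!: entries)
    ultimately have "det (mat_delete ?M j i) \<in> S"
      by (intro det_mem) auto
    then show ?thesis
      using that M by (simp add: adj_mat_def cofactor_def)
  qed
  \<comment> \<open>The coefficient vector of \<open>h\<close> times the inverse of the Sylvester
    matrix.\<close>
  define w where "w i = (\<Sum>k<2*d. e * Polynomial.coeff h k * ?A $$ (k, i))" for i
  define u where "u = fst (pair_poly d w)"
  define v where "v = snd (pair_poly d w)"
  have w: "w i \<in> S" if "i < 2 * d" for i
    unfolding w_def using that A_mem e(2) h(1) by (intro sum_mem mult_mem) (auto simp: polys_over_def)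
  have deg: "Polynomial.degree u < d" "Polynomial.degree v < d"
    unfolding u_def v_def using degree_pair_poly[OF assms(1)] by auto
  have "u \<in> polys_over" "v \<in> polys_over"
    unfolding u_def v_def pair_poly_def using w by (auto intro!: polys_over_sum polys_over_monom)
  moreover have "h = u * form_poly d a + v * form_poly d b"
  proof (rule poly_eqI)
    fix j
    show "Polynomial.coeff h j = Polynomial.coeff (u * form_poly d a + v * form_poly d b) j"
    proof (cases "j < 2 * d")
      case True
      have "Polynomial.coeff (u * form_poly d a + v * form_poly d b) j = (\<Sum>i<2*d. w i * ?M $$ (i, j))"
        by (simp only: u_def v_def pair_poly_mult_sylvester[OF True])
      also have "\<dots> = (\<Sum>k<2*d. e * Polynomial.coeff h k * (\<Sum>i<2*d. ?A $$ (k, i) * ?M $$ (i, j)))"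
        unfolding w_def sum_distrib_right sum_distrib_left
        by (subst sum.swap) (simp add: mult.assoc)
      also have "\<dots> = (\<Sum>k<2*d. e * Polynomial.coeff h k * (?A * ?M) $$ (k, j))"
        using True A M by (intro sum.cong) (auto simp: scalar_prod_def atLeast0LessThan)
      also have "\<dots> = (\<Sum>k<2*d. if k = j then e * det ?M * Polynomial.coeff h k else 0)"
        unfolding AM using True by (intro sum.cong) auto
      also have "\<dots> = Polynomial.coeff h j"
        using True e(1) by simp
      finally show ?thesis ..
    next
      case False
      have "Polynomial.degree (u * form_poly d a) < 2 * d" "Polynomial.degree (v * form_poly d b) < 2 * d"
        using deg degree_form_poly[of d a] degree_form_poly[of d b] degree_mult_le[of u "form_poly d a"]
          degree_mult_le[of v "form_poly d b"] by linarith+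
      then show ?thesis
        using False h(2) by (simp add: coeff_eq_0)
    qed
  qed
  ultimately show "\<exists>u\<in>polys_over. \<exists>v\<in>polys_over. Polynomial.degree u < d \<and> Polynomial.degree v < d \<and>
      h = u * form_poly d a + v * form_poly d b"
    using deg by blast
qed

end

lemma form_resultant_scale: "form_resultant d (\<lambda>i. c * a i, \<lambda>i. c * b i) = c ^ (2 * d) * form_resultant d (a, b)"
proof -
  have "model_sylvester d (\<lambda>i. c * a i) (\<lambda>i. c * b i) = c \<cdot>\<^sub>m model_sylvester d a b"
  proof (rule eq_matI)
    fix i j assume "i < dim_row (c \<cdot>\<^sub>m model_sylvester d a b)" "j < dim_col (c \<cdot>\<^sub>m model_sylvester d a b)"
    then have "i < 2 * d" "j < 2 * d"
      using model_sylvester_carrier[of d a b] by auto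
    moreover have "dim_row (model_sylvester d a b) = 2 * d" "dim_col (model_sylvester d a b) = 2 * d"
      using model_sylvester_carrier[of d a b] by auto
    ultimately show "model_sylvester d (\<lambda>i. c * a i) (\<lambda>i. c * b i) $$ (i, j) = (c \<cdot>\<^sub>m model_sylvester d a b) $$ (i, j)"
      by (simp add: model_sylvester_index coeff_monom_mult form_poly_scale)
  qed (simp_all add: model_sylvester_def)
  then show ?thesis
    unfolding form_resultant_eq using model_sylvester_carrier[of d a b] by simp
qed

lemma form_resultant_cong:
  assumes "\<And>i. i \<le> d \<Longrightarrow> a i = a' i" "\<And>i. i \<le> d \<Longrightarrow> b i = b' i"
  shows "form_resultant d (a, b) = form_resultant d (a', b')"
proof -
  have "dehomogenize d a = dehomogenize d a'" "dehomogenize d b = dehomogenize d b'"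
    using assms unfolding dehomogenize_def by (intro sum.cong; simp)+
  then show ?thesis by simp
qed

section \<open>Presentations of a morphism\<close>

fun det2 :: "'a::comm_ring_1 matrix2 \<Rightarrow> 'a" where
  "det2 (\<alpha>, \<beta>, \<gamma>, \<delta>) = \<alpha> * \<delta> - \<beta> * \<gamma>"

fun inv2 :: "'a::field matrix2 \<Rightarrow> 'a matrix2" where
  "inv2 (\<alpha>, \<beta>, \<gamma>, \<delta>) = (let e = inverse (\<alpha> * \<delta> - \<beta> * \<gamma>) in (e * \<delta>, - (e * \<beta>), - (e * \<gamma>), e * \<alpha>))"

lemma det2_mult: "det2 (matrix2_mult \<Gamma> \<Delta>) = det2 \<Gamma> * det2 \<Delta>"
  by (cases \<Gamma>; cases \<Delta>) (simp add: algebra_simps)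

lemma matrix2_mult_inv2:
  assumes "det2 \<Gamma> \<noteq> 0"
  shows "matrix2_mult \<Gamma> (inv2 \<Gamma>) = (1, 0, 0, 1)"
proof -
  obtain \<alpha> \<beta> \<gamma> \<delta> where \<Gamma>: "\<Gamma> = (\<alpha>, \<beta>, \<gamma>, \<delta>)"
    by (cases \<Gamma>)
  define e where "e = inverse (\<alpha> * \<delta> - \<beta> * \<gamma>)"
  have "e * (\<alpha> * \<delta> - \<beta> * \<gamma>) = 1"
    using assms by (simp add: e_def \<Gamma>)
  then show ?thesis
    by (simp add: \<Gamma> Let_def algebra_simps flip: e_def)
qed

lemma det2_inv2:
  assumes "det2 \<Gamma> \<noteq> 0"
  shows "det2 (inv2 \<Gamma>) \<noteq> 0"
  using det2_mult[of \<Gamma> "inv2 \<Gamma>"] unfolding matrix2_mult_inv2[OF assms] by auto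

lemma GL2_base_field: "GL2 base_field \<Gamma> \<longleftrightarrow> det2 \<Gamma> \<noteq> 0"
  by (cases \<Gamma>) (simp add: type_algebra_Units type_algebra_minus)

text \<open>Over an algebraically closed field the absence of common roots replaces coprimality: a
  root of \<open>f\<close> is not a root of \<open>g\<close>, hence is one of \<open>v\<close>, and
  the linear factor can be removed from both \<open>f\<close> and \<open>v\<close>.\<close>

lemma dvd_mult_coprime_roots:
  fixes f g v :: "'a::alg_closed_field poly"
  assumes "f \<noteq> 0" "\<And>x. \<not> (poly f x = 0 \<and> poly g x = 0)" "f dvd v * g"
  shows "f dvd v"
  using assms
proof (induction "Polynomial.degree f" arbitrary: f v)
  case 0
  then have "is_unit f"
    by (metis is_unit_iff_degree)
  then show ?case by (rule unit_imp_dvd)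
next
  case (Suc n)
  then have "Polynomial.degree f > 0" by simp
  then obtain x where x: "poly f x = 0"
    using alg_closed_imp_poly_has_root by blast
  then obtain f' where f': "f = [:- x, 1:] * f'"
    by (metis poly_eq_0_iff_dvd dvdE)
  obtain q where q: "v * g = f * q"
    using Suc.prems(3) by (rule dvdE)
  have "poly g x \<noteq> 0"
    using Suc.prems(2) x by blast
  moreover have "poly v x * poly g x = 0"
    using x by (metis q poly_mult mult_zero_left)
  ultimately have "poly v x = 0" by simp
  then obtain v' where v': "v = [:- x, 1:] * v'"
    by (metis poly_eq_0_iff_dvd dvdE)
  have "[:- x, 1:] * (v' * g) = [:- x, 1:] * (f' * q)"
    using q unfolding f' v' by (simp only: mult.assoc)
  then have "v' * g = f' * q"
    by (metis mult_left_cancel pCons_eq_0_iff zero_neq_one)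
  then have dvd: "f' dvd v' * g" by simp
  have f0: "f' \<noteq> 0"
    using Suc.prems(1) f' by auto
  have deg: "n = Polynomial.degree f'"
  proof -
    have "Polynomial.degree f = Polynomial.degree [:- x, 1:] + Polynomial.degree f'"
      unfolding f' by (rule degree_mult_eq) (use f0 in auto)
    then show ?thesis
      using Suc.hyps(2) by simp
  qed
  have no_root: "\<not> (poly f' y = 0 \<and> poly g y = 0)" for y
    using Suc.prems(2)[of y] by (auto simp: f')
  have "f' dvd v'"
    by (rule Suc.hyps(1)[OF deg f0 no_root dvd])
  then show ?case
    unfolding f' v' by (rule mult_dvd_mono[OF dvd_refl])
qed

text \<open>Coprimality makes \<open>f\<close> divide \<open>f'\<close>, and the degree bound forces
  the quotient to be constant.\<close>

lemma proportional_of_cross_mult: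
  fixes f g f' g' :: "'a::alg_closed_field poly"
  assumes "f \<noteq> 0" "\<And>x. \<not> (poly f x = 0 \<and> poly g x = 0)"
    and "Polynomial.degree f' \<le> Polynomial.degree f" "f * g' = f' * g"
  shows "\<exists>c. f' = Polynomial.smult c f \<and> g' = Polynomial.smult c g"
proof -
  have "f dvd f' * g"
    using assms(4) by (metis dvd_triv_left)
  then have "f dvd f'"
    using dvd_mult_coprime_roots assms(1,2) by blast
  then obtain k where k: "f' = f * k" ..
  have "Polynomial.degree k = 0"
    using assms(1,3) by (cases "k = 0") (auto simp: k degree_mult_eq)
  then obtain c where c: "k = [:c:]"
    by (rule degree_eq_zeroE)
  have "f * g' = f * Polynomial.smult c g"
    using assms(4) by (simp add: k c)
  then have "g' = Polynomial.smult c g"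
    using mult_left_cancel[OF assms(1)] by blast
  then show ?thesis
    using k c by (intro exI[of _ c]) simp
qed

section \<open>Presentations as pairs of polynomials over the algebraic closure\<close>

definition ac_poly :: "nat \<Rightarrow> 'k::field_char_0 form \<Rightarrow> 'k alg_closure poly" where
  "ac_poly d a = form_poly d (\<lambda>i. to_ac (a i))"

lemma poly_ac_poly: "poly (ac_poly d a) y = form_eval d a 1 y"
  by (simp add: ac_poly_def form_poly_def form_eval_def poly_sum poly_monom)

lemma form_eval_infinity: "form_eval d a 0 1 = to_ac (a d)"
proof -
  have "form_eval d a 0 1 = (\<Sum>i\<le>d. if i = d then to_ac (a i) else 0)"
    unfolding form_eval_def by (intro sum.cong) auto
  then show ?thesis by simp
qed

lemma proj_point_eqD:
  assumes "proj_point x y = proj_point x' y'"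
  shows "x * y' = x' * y"
proof -
  have "(x, y) \<in> proj_point x y"
    unfolding proj_point_def by (intro CollectI exI[of _ 1]) simp
  then obtain c where "x = c * x'" "y = c * y'"
    unfolding assms unfolding proj_point_def by auto
  then show ?thesis by simp
qed

lemma infinite_alg_closure: "infinite (UNIV :: 'k::field_char_0 alg_closure set)"
proof -
  have "inj (\<lambda>n. to_ac (of_nat n :: 'k))"
    by (rule injI) (simp only: to_ac_eq_iff of_nat_eq_iff)
  then have "infinite (range (\<lambda>n. to_ac (of_nat n :: 'k)))"
    using finite_imageD infinite_UNIV_nat by blast
  then show ?thesis
    using finite_subset subset_UNIV by blast
qed

lemma poly_eqI_values:
  fixes p q :: "'k::field_char_0 alg_closure poly"
  assumes "\<And>y. poly p y = poly q y"
  shows "p = q"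
proof (rule ccontr)
  assume "p \<noteq> q"
  then have "finite {y. poly (p - q) y = 0}"
    by (intro poly_roots_finite) simp
  then show False
    using assms infinite_alg_closure[where 'k = 'k] by simp
qed

text \<open>The points [1:y] exclude common roots. The remaining point [0:1] sees only the
  coefficients of index \<open>d\<close>, one of which must be nonzero; this is the full degree
  claimed.\<close>

lemma fixed_presentationD:
  assumes "fixed_presentation d \<phi> (a, b)"
  shows "\<not> (poly (ac_poly d a) y = 0 \<and> poly (ac_poly d b) y = 0)"
    and "Polynomial.degree (ac_poly d a) = d \<or> Polynomial.degree (ac_poly d b) = d"
proof -
  have nz: "(form_eval d a x y, form_eval d b x y) \<noteq> (0, 0)" if "(x, y) \<noteq> (0, 0)" for x y
    using assms that by simp
  show "\<not> (poly (ac_poly d a) y = 0 \<and> poly (ac_poly d b) y = 0)"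
    using nz[of 1 y] by (simp add: poly_ac_poly)
  have "a d \<noteq> 0 \<or> b d \<noteq> 0"
    using nz[of 0 1] by (simp add: form_eval_infinity)
  moreover have "Polynomial.degree (ac_poly d c) = d" if "c d \<noteq> 0" for c
    using that degree_form_poly[of d "\<lambda>i. to_ac (c i)"] unfolding ac_poly_def
    by (intro antisym le_degree) (simp_all add: coeff_form_poly)
  ultimately show "Polynomial.degree (ac_poly d a) = d \<or> Polynomial.degree (ac_poly d b) = d"
    by blast
qed

lemma coeff_ac_poly: "Polynomial.coeff (ac_poly d a) i = (if i \<le> d then to_ac (a i) else 0)"
  by (simp add: ac_poly_def coeff_form_poly)

text \<open>Equal values at all points [1:y] give equality of cross products as polynomials, because
  the closure is infinite; coprimality then gives proportionality.\<close>

lemma fixed_presentation_unique: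
  assumes "0 < d" "fixed_presentation d \<phi> (a, b)" "fixed_presentation d \<phi> (a', b')"
  shows "\<exists>c. c \<noteq> 0 \<and> (\<forall>i\<le>d. a' i = c * a i \<and> b' i = c * b i)"
proof -
  let ?f = "ac_poly d a" and ?g = "ac_poly d b" and ?f' = "ac_poly d a'" and ?g' = "ac_poly d b'"
  have cross: "?f * ?g' = ?f' * ?g"
  proof (rule poly_eqI_values)
    fix y
    have "\<phi> (proj_point 1 y) = proj_point (form_eval d a 1 y) (form_eval d b 1 y)"
      using assms(2) by simp
    moreover have "\<phi> (proj_point 1 y) = proj_point (form_eval d a' 1 y) (form_eval d b' 1 y)"
      using assms(3) by simp
    ultimately have "proj_point (form_eval d a 1 y) (form_eval d b 1 y) =
        proj_point (form_eval d a' 1 y) (form_eval d b' 1 y)"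
      by simp
    from proj_point_eqD[OF this] show "poly (?f * ?g') y = poly (?f' * ?g) y"
      by (simp add: poly_ac_poly)
  qed
  have deg: "Polynomial.degree ?f' \<le> d" "Polynomial.degree ?g' \<le> d"
    by (simp_all add: ac_poly_def degree_form_poly)
  note no_root = fixed_presentationD(1)[OF assms(2)]
  \<comment> \<open>The divisor in \<open>proportional_of_cross_mult\<close> must have full degree,
    which may hold for either form.\<close>
  from fixed_presentationD(2)[OF assms(2)]
  obtain c where c: "?f' = Polynomial.smult c ?f" "?g' = Polynomial.smult c ?g"
  proof
    assume f: "Polynomial.degree ?f = d"
    then have "?f \<noteq> 0" using assms(1) by auto
    from proportional_of_cross_mult[OF this no_root _ cross] f deg that show ?thesis
      by auto
  next
    assume g: "Polynomial.degree ?g = d"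
    then have "?g \<noteq> 0" using assms(1) by auto
    moreover have "?g * ?f' = ?g' * ?f" using cross by (simp add: mult.commute)
    moreover have "\<not> (poly ?g y = 0 \<and> poly ?f y = 0)" for y
      using no_root[of y] by blast
    ultimately show ?thesis
      using proportional_of_cross_mult[of ?g ?f ?g' ?f'] g deg that by auto
  qed
  have "c \<noteq> 0"
    using c fixed_presentationD(1)[OF assms(3), of 0] by auto
  have ac: "to_ac (a' i) = c * to_ac (a i)" "to_ac (b' i) = c * to_ac (b i)" if "i \<le> d" for i
    using that c by (metis coeff_ac_poly coeff_smult)+
  have "a d \<noteq> 0 \<or> b d \<noteq> 0"
  proof -
    have "(form_eval d a 0 1, form_eval d b 0 1) \<noteq> (0, 0)"
      using assms(2) by simp
    then show ?thesis by (simp add: form_eval_infinity)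
  qed
  \<comment> \<open>So far \<open>c\<close> lies only in the algebraic closure; as a quotient of two
    coefficients of index \<open>d\<close> it comes from the field.\<close>
  then obtain c' where c': "c = to_ac c'"
  proof
    assume "a d \<noteq> 0"
    then have "c = to_ac (a' d / a d)" using ac(1)[of d] by simp
    then show ?thesis by (rule that)
  next
    assume "b d \<noteq> 0"
    then have "c = to_ac (b' d / b d)" using ac(2)[of d] by simp
    then show ?thesis by (rule that)
  qed
  have "to_ac (a' i) = to_ac (c' * a i)" "to_ac (b' i) = to_ac (c' * b i)" if "i \<le> d" for i
    using ac[OF that] by (simp_all add: c')
  then show ?thesis
    using \<open>c \<noteq> 0\<close> unfolding c' to_ac_eq_iff by (intro exI[of _ c']) auto
qed

text \<open>For \<open>S\<close> the whole field, \<open>spanning\<close> amounts to a nonzero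
  resultant.\<close>

interpretation UNIV_subring: subring_of_field "UNIV :: 'k::field_char_0 set"
  by unfold_locales auto

text \<open>A vector killed by the transposed Sylvester matrix is a relation between the two forms
  with cofactors of degree below \<open>d\<close>. By coprimality the form of full degree divides
  the cofactor of the other one, so both cofactors vanish.\<close>

lemma form_resultant_nonzero_of_coprime:
  assumes "0 < d" "\<And>y. \<not> (poly (ac_poly d a) y = 0 \<and> poly (ac_poly d b) y = 0)"
    and "Polynomial.degree (ac_poly d a) = d \<or> Polynomial.degree (ac_poly d b) = d"
  shows "form_resultant d (a, b) \<noteq> 0"
proof
  assume "form_resultant d (a, b) = 0"
  then have "det (transpose_mat (model_sylvester d a b)) = 0"
    unfolding form_resultant_eq det_transpose[OF model_sylvester_carrier] .
  then obtain v where v: "v \<in> carrier_vec (2 * d)" "v \<noteq> 0\<^sub>v (2 * d)"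
      "transpose_mat (model_sylvester d a b) *\<^sub>v v = 0\<^sub>v (2 * d)"
    using det_0_iff_vec_prod_zero_field[of "transpose_mat (model_sylvester d a b)" "2 * d"]
      model_sylvester_carrier[of d a b] by auto
  define w where "w i = v $ i" for i
  define p where "p = fst (pair_poly d w)"
  define q where "q = snd (pair_poly d w)"
  have deg: "Polynomial.degree p < d" "Polynomial.degree q < d"
    unfolding p_def q_def using degree_pair_poly[OF assms(1)] by auto
  have rel: "p * form_poly d a + q * form_poly d b = 0"
  proof (rule poly_eqI)
    fix j
    show "Polynomial.coeff (p * form_poly d a + q * form_poly d b) j = Polynomial.coeff 0 j"
    proof (cases "j < 2 * d")
      case True
      have "Polynomial.coeff (p * form_poly d a + q * form_poly d b) j =
          (\<Sum>i<2*d. w i * model_sylvester d a b $$ (i, j))"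
        by (simp only: p_def q_def pair_poly_mult_sylvester[OF True])
      also have "\<dots> = (transpose_mat (model_sylvester d a b) *\<^sub>v v) $ j"
        using True v(1) model_sylvester_carrier[of d a b]
        by (simp add: scalar_prod_def w_def atLeast0LessThan mult.commute)
      finally show ?thesis
        using v(3) True by simp
    next
      case False
      have "Polynomial.degree (p * form_poly d a) < 2 * d" "Polynomial.degree (q * form_poly d b) < 2 * d"
        using deg degree_form_poly[of d a] degree_form_poly[of d b] degree_mult_le[of p "form_poly d a"]
          degree_mult_le[of q "form_poly d b"] by linarith+
      then show ?thesis
        using False by (simp add: coeff_eq_0)
    qed
  qed
  \<comment> \<open>The relation is moved to the algebraic closure, where coprimality is expressed
    by roots.\<close>
  interpret ac: inj_idom_hom "to_ac :: 'a \<Rightarrow> 'a alg_closure"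
    by unfold_locales auto
  interpret ac_poly: map_poly_inj_idom_hom "to_ac :: 'a \<Rightarrow> 'a alg_closure" ..
  define P where "P = map_poly to_ac p"
  define Q where "Q = map_poly to_ac q"
  have ac_poly: "ac_poly d c = map_poly to_ac (form_poly d c)" for c
    by (rule poly_eqI) (simp add: coeff_ac_poly coeff_form_poly coeff_map_poly)
  have REL: "P * ac_poly d a + Q * ac_poly d b = 0"
    using arg_cong[OF rel, of "map_poly to_ac"] unfolding P_def Q_def ac_poly
    by (simp only: ac_poly.hom_add ac_poly.hom_mult ac_poly.hom_zero)
  have DEG: "Polynomial.degree P < d" "Polynomial.degree Q < d"
    using deg by (simp_all add: P_def Q_def)
  have small: "R = 0" if "f dvd R" "Polynomial.degree R < d" "Polynomial.degree f = d"
    for f R :: "'a alg_closure poly"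
    using that dvd_imp_degree_le[of f R] by fastforce
  have "P = 0 \<and> Q = 0"
    using assms(3)
  proof
    assume f: "Polynomial.degree (ac_poly d a) = d"
    then have f0: "ac_poly d a \<noteq> 0" using assms(1) by auto
    have "Q * ac_poly d b = ac_poly d a * (- P)"
      using REL by (simp add: algebra_simps eq_neg_iff_add_eq_0)
    then have "ac_poly d a dvd Q"
      using dvd_mult_coprime_roots[of "ac_poly d a" "ac_poly d b" Q] f0 assms(2) by (metis dvd_triv_left)
    then have "Q = 0" using small DEG f by blast
    then show ?thesis using REL f0 by auto
  next
    assume g: "Polynomial.degree (ac_poly d b) = d"
    then have g0: "ac_poly d b \<noteq> 0" using assms(1) by auto
    have "P * ac_poly d a = ac_poly d b * (- Q)"
      using REL by (simp add: algebra_simps eq_neg_iff_add_eq_0)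
    then have "ac_poly d b dvd P"
      using dvd_mult_coprime_roots[of "ac_poly d b" "ac_poly d a" P] g0 assms(2) by (metis dvd_triv_left)
    then have "P = 0" using small DEG g by blast
    then show ?thesis using REL g0 by auto
  qed
  then have pq: "p = 0" "q = 0"
    by (simp_all add: P_def Q_def)
  have "w i = 0" if "i < 2 * d" for i
  proof (cases "i < d")
    case True
    then show ?thesis using coeff_pair_poly(1)[of i d w] pq(1) by (simp add: p_def)
  next
    case False
    then show ?thesis using coeff_pair_poly(2)[of "i - d" d w] pq(2) that by (simp add: q_def)
  qed
  then have "v = 0\<^sub>v (2 * d)"
    using v(1) by (intro eq_vecI) (auto simp: w_def)
  then show False using v(2) by simp
qed

section \<open>Comparison of two presentations of one morphism\<close>

lemma poly_conj_inv2:
  assumes "det2 \<Gamma> \<noteq> 0" "Polynomial.degree f \<le> d" "Polynomial.degree g \<le> d"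
  shows "poly_conj d (inv2 \<Gamma>) (poly_conj d \<Gamma> (f, g)) = (f, g)"
  unfolding poly_conj_mult matrix2_mult_inv2[OF assms(1)]
  using poly_conj_scalar[OF assms(2,3), of 1] by simp

lemma presentationE:
  assumes "presentation d \<phi> (a, b)"
  obtains a' b' \<Gamma> where "fixed_presentation d \<phi> (a', b')" "det2 \<Gamma> \<noteq> 0"
    "(form_poly d a, form_poly d b) = poly_conj d \<Gamma> (form_poly d a', form_poly d b')"
proof -
  obtain \<Phi> \<Gamma> where *: "fixed_presentation d \<phi> \<Phi>" "GL2 base_field \<Gamma>"
    "\<forall>i\<le>d. a i = fst (conj_model base_field d \<Gamma> \<Phi>) i \<and> b i = snd (conj_model base_field d \<Gamma> \<Phi>) i"
    using assms unfolding presentation_def fst_conv snd_conv by blast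
  obtain a' b' where \<Phi>: "\<Phi> = (a', b')" by (cases \<Phi>)
  have "form_poly d a = form_poly d (fst (conj_model base_field d \<Gamma> \<Phi>))"
    "form_poly d b = form_poly d (snd (conj_model base_field d \<Gamma> \<Phi>))"
    using *(3) by (auto intro!: form_poly_eqI)
  then have "(form_poly d a, form_poly d b) = poly_conj d \<Gamma> (form_poly d a', form_poly d b')"
    unfolding \<Phi> by (simp add: form_poly_conj_model)
  then show ?thesis
    using that *(1,2) unfolding \<Phi> GL2_base_field by blast
qed

text \<open>In the fixed coordinates this is coprimality; \<open>spanning\<close> over the whole
  field carries it to all other coordinates.\<close>

lemma presentation_resultant_nonzero:
  assumes "0 < d" "presentation d \<phi> (a, b)"
  shows "form_resultant d (a, b) \<noteq> 0"
proof -
  obtain a' b' \<Gamma> where *: "fixed_presentation d \<phi> (a', b')" "det2 \<Gamma> \<noteq> 0"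
    "(form_poly d a, form_poly d b) = poly_conj d \<Gamma> (form_poly d a', form_poly d b')"
    using assms(2) by (rule presentationE)
  obtain \<alpha> \<beta> \<gamma> \<delta> where \<Gamma>: "\<Gamma> = (\<alpha>, \<beta>, \<gamma>, \<delta>)"
    by (cases \<Gamma>)
  have "form_resultant d (a', b') \<noteq> 0"
    using form_resultant_nonzero_of_coprime[OF assms(1)] fixed_presentationD(1,2)[OF *(1)] by blast
  then have "UNIV_subring.spanning d (form_poly d a') (form_poly d b')"
    using assms(1) by (intro UNIV_subring.unit_resultant_imp_spanning) auto
  then have "UNIV_subring.spanning d (fst (form_poly d a, form_poly d b)) (snd (form_poly d a, form_poly d b))"
    unfolding *(3) \<Gamma> using assms(1) *(2)[unfolded \<Gamma>]
    by (intro UNIV_subring.spanning_poly_conj) (auto simp: degree_form_poly)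
  then show ?thesis
    using UNIV_subring.spanning_imp_unit_resultant by simp
qed

text \<open>Undo the first change of coordinates, compare in the fixed coordinates, where a
  presentation is unique up to a scalar, and apply the second change.\<close>

lemma presentations_conjugate:
  assumes "0 < d" "presentation d \<phi> (a, b)" "presentation d \<phi> (a', b')"
  obtains c \<Gamma> where "c \<noteq> 0" "det2 \<Gamma> \<noteq> 0"
    "(form_poly d a', form_poly d b') =
      poly_conj d \<Gamma> (form_poly d (\<lambda>i. c * a i), form_poly d (\<lambda>i. c * b i))"
proof -
  obtain a1 b1 \<Gamma>1 where 1: "fixed_presentation d \<phi> (a1, b1)" "det2 \<Gamma>1 \<noteq> 0"
    "(form_poly d a, form_poly d b) = poly_conj d \<Gamma>1 (form_poly d a1, form_poly d b1)"
    using assms(2) by (rule presentationE)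
  obtain a2 b2 \<Gamma>2 where 2: "fixed_presentation d \<phi> (a2, b2)" "det2 \<Gamma>2 \<noteq> 0"
    "(form_poly d a', form_poly d b') = poly_conj d \<Gamma>2 (form_poly d a2, form_poly d b2)"
    using assms(3) by (rule presentationE)
  obtain c where c: "c \<noteq> 0" "\<forall>i\<le>d. a2 i = c * a1 i \<and> b2 i = c * b1 i"
    using fixed_presentation_unique[OF assms(1) 1(1) 2(1)] by blast
  have e: "form_poly d a2 = Polynomial.smult c (form_poly d a1)"
    "form_poly d b2 = Polynomial.smult c (form_poly d b1)"
    using c(2) by (auto simp flip: form_poly_scale intro!: form_poly_eqI)
  have "(form_poly d a1, form_poly d b1) = poly_conj d (inv2 \<Gamma>1) (form_poly d a, form_poly d b)"
    unfolding 1(3) using poly_conj_inv2[OF 1(2)] degree_form_poly by metis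
  then have "(form_poly d a', form_poly d b') =
      map_prod (Polynomial.smult c) (Polynomial.smult c)
        (poly_conj d (matrix2_mult (inv2 \<Gamma>1) \<Gamma>2) (form_poly d a, form_poly d b))"
    unfolding 2(3) e poly_conj_smult by (simp add: poly_conj_mult)
  then have "(form_poly d a', form_poly d b') = poly_conj d (matrix2_mult (inv2 \<Gamma>1) \<Gamma>2)
      (form_poly d (\<lambda>i. c * a i), form_poly d (\<lambda>i. c * b i))"
    by (simp add: form_poly_scale poly_conj_smult)
  moreover have "det2 (matrix2_mult (inv2 \<Gamma>1) \<Gamma>2) \<noteq> 0"
    using 2(2) det2_inv2[OF 1(2)] by (simp add: det2_mult)
  ultimately show ?thesis
    using that c(1) by blast
qed

section \<open>Discrete valuation rings in the base field\<close>

text \<open>The assumption \<open>factorization\<close> ranges over all nonzero elements of the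
  field, not only of \<open>S\<close>, and so contains the fact that the field is the fraction field
  of \<open>S\<close>.\<close>

locale dvr_in_field = subring_of_field S for S :: "'k::field_char_0 set" +
  fixes \<pi> :: 'k
  assumes pi_mem: "\<pi> \<in> S" and pi_nz [simp]: "\<pi> \<noteq> 0" and inverse_pi: "inverse \<pi> \<notin> S"
    and factorization: "\<And>x. x \<noteq> 0 \<Longrightarrow> \<exists>u n. u \<noteq> 0 \<and> u \<in> S \<and> inverse u \<in> S \<and> x = u * \<pi> powi n"
    and max_ideal_eq: "max_ideal S = {s * \<pi> | s. s \<in> S}"
    and maximal: "maximalideal (max_ideal S) (sub_ring S)"
    and cring_sub: "cring (sub_ring S)"
begin

definition unit :: "'k \<Rightarrow> bool" where
  "unit u \<longleftrightarrow> u \<noteq> 0 \<and> u \<in> S \<and> inverse u \<in> S"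

lemma Units_sub_ring: "Units (sub_ring S) = Collect unit"
proof (intro equalityI subsetI)
  fix u assume "u \<in> Units (sub_ring S)"
  then obtain v where v: "u \<in> S" "v \<in> S" "u * v = 1"
    by (auto simp: Units_def)
  then have "inverse u = v" "u \<noteq> 0"
    by (auto intro: inverse_unique)
  then show "u \<in> Collect unit" using v by (simp add: unit_def)
next
  fix u assume "u \<in> Collect unit"
  then show "u \<in> Units (sub_ring S)"
    by (auto simp: Units_def unit_def intro!: bexI[of _ "inverse u"])
qed

lemma unit_mult: "unit u \<Longrightarrow> unit v \<Longrightarrow> unit (u * v)"
  by (simp add: unit_def inverse_mult_distrib)

lemma unit_inverse: "unit u \<Longrightarrow> unit (inverse u)"
  by (simp add: unit_def)

lemma unit_powi: "unit u \<Longrightarrow> unit (u powi n)"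
  by (auto simp: unit_def power_int_def simp flip: power_inverse)

lemma pi_powi_mem: "\<pi> powi n \<in> S \<longleftrightarrow> 0 \<le> n"
proof
  show "\<pi> powi n \<in> S" if "0 \<le> n"
    using that pi_mem by (simp add: power_int_def)
  show "0 \<le> n" if "\<pi> powi n \<in> S"
  proof (rule ccontr)
    assume "\<not> 0 \<le> n"
    then obtain m where m: "n = - int (Suc m)"
      by (metis int_cases not_le of_nat_0_le_iff)
    have "inverse \<pi> = \<pi> ^ m * \<pi> powi n"
      unfolding m power_int_minus power_int_of_nat by (simp add: field_simps)
    then show False
      using that pi_mem inverse_pi by (metis mult_mem power_mem)
  qed
qed

lemma unit_pi_powi: "unit (\<pi> powi n) \<longleftrightarrow> n = 0"
proof -
  have "inverse (\<pi> powi n) = \<pi> powi (- n)"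
    by (simp add: power_int_minus)
  then show ?thesis
    unfolding unit_def by (auto simp: pi_powi_mem)
qed

text \<open>Generators of one principal ideal differ by a unit. The description is needed because
  \<open>val\<close> quantifies over all uniformizers.\<close>

lemma uniformizer_iff: "uniformizer S t \<longleftrightarrow> (\<exists>w. unit w \<and> t = w * \<pi>)"
proof
  assume "uniformizer S t"
  then have t: "t \<in> S" and eq: "{s * \<pi> | s. s \<in> S} = {s * t | s. s \<in> S}"
    by (auto simp: uniformizer_def max_ideal_eq cgenideal_def)
  have "1 * t \<in> {s * t | s. s \<in> S}" "1 * \<pi> \<in> {s * \<pi> | s. s \<in> S}"
    by (intro CollectI exI[of _ 1] conjI refl one_mem)+
  then have "t \<in> {s * \<pi> | s. s \<in> S}" "\<pi> \<in> {s * t | s. s \<in> S}"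
    unfolding eq by simp_all
  then obtain w v where w: "w \<in> S" "t = w * \<pi>" and v: "v \<in> S" "\<pi> = v * t"
    by blast
  have "w * v * \<pi> = v * t" by (subst w(2)) (simp only: mult_ac)
  also have "\<dots> = 1 * \<pi>" using v(2) by simp
  finally have "w * v = 1" using pi_nz mult_right_cancel by blast
  then have "w \<noteq> 0" "inverse w = v" by (auto intro: inverse_unique)
  then have "unit w" using w(1) v(1) by (simp add: unit_def)
  then show "\<exists>w. unit w \<and> t = w * \<pi>" using w(2) by blast
next
  assume "\<exists>w. unit w \<and> t = w * \<pi>"
  then obtain w where w: "w \<noteq> 0" "w \<in> S" "inverse w \<in> S" "t = w * \<pi>"
    by (auto simp: unit_def)
  have "\<exists>r. s * \<pi> = r * t \<and> r \<in> S" "\<exists>r. s * t = r * \<pi> \<and> r \<in> S" if "s \<in> S" for s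
  proof -
    have "s * \<pi> = (s * inverse w) * t" "s * t = (s * w) * \<pi>"
      using w by simp_all
    moreover have "s * inverse w \<in> S" "s * w \<in> S"
      using that w by simp_all
    ultimately show "\<exists>r. s * \<pi> = r * t \<and> r \<in> S" "\<exists>r. s * t = r * \<pi> \<and> r \<in> S"
      by blast+
  qed
  then have "{s * \<pi> | s. s \<in> S} = {s * t | s. s \<in> S}"
    by blast
  then show "uniformizer S t"
    using w pi_mem by (auto simp: uniformizer_def max_ideal_eq cgenideal_def)
qed

text \<open>For the uniqueness hidden in \<open>THE\<close>: another uniformizer changes only the
  unit factor, and a power of \<open>\<pi>\<close> that is a unit has exponent 0.\<close>

lemma val_eq:
  assumes "unit u"
  shows "val S (u * \<pi> powi n) = n"
  unfolding val_def
proof (rule the_equality)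
  have "uniformizer S \<pi>"
    unfolding uniformizer_iff by (rule exI[of _ 1]) (simp add: unit_def)
  then show "\<exists>t v. uniformizer S t \<and> v \<in> Units (sub_ring S) \<and> u * \<pi> powi n = v * t powi n"
    using assms by (intro exI[of _ \<pi>] exI[of _ u]) (simp add: Units_sub_ring)
next
  fix m assume "\<exists>t v. uniformizer S t \<and> v \<in> Units (sub_ring S) \<and> u * \<pi> powi n = v * t powi m"
  then obtain w v where w: "unit w" "unit v" and eq: "u * \<pi> powi n = v * (w * \<pi>) powi m"
    by (auto simp: uniformizer_iff Units_sub_ring)
  have "u \<noteq> 0" using assms by (simp add: unit_def)
  have "\<pi> powi (n - m) = inverse u * (v * w powi m)"
    using eq \<open>u \<noteq> 0\<close> by (simp add: power_int_diff power_int_mult_distrib field_simps)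
  then have "unit (\<pi> powi (n - m))"
    using assms w by (simp add: unit_mult unit_inverse unit_powi)
  then show "m = n" by (simp add: unit_pi_powi)
qed

lemma valE:
  assumes "x \<noteq> 0"
  obtains u where "unit u" "x = u * \<pi> powi val S x"
proof -
  obtain u n where u: "unit u" "x = u * \<pi> powi n"
    using factorization[OF assms] unfolding unit_def by blast
  then have "val S x = n" using val_eq by simp
  then show ?thesis using that u by blast
qed

lemma val_mult:
  assumes "x \<noteq> 0" "y \<noteq> 0"
  shows "val S (x * y) = val S x + val S y"
proof -
  obtain u where u: "unit u" "x = u * \<pi> powi val S x" using assms(1) by (rule valE)
  obtain v where v: "unit v" "y = v * \<pi> powi val S y" using assms(2) by (rule valE)
  have "x * y = (u * v) * \<pi> powi (val S x + val S y)"
    by (subst u(2), subst v(2)) (simp add: power_int_add)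
  then show ?thesis using val_eq[OF unit_mult[OF u(1) v(1)]] by simp
qed

lemma val_power:
  assumes "x \<noteq> 0"
  shows "val S (x ^ n) = int n * val S x"
proof (induction n)
  case 0
  show ?case using val_eq[of 1 0] by (simp add: unit_def)
next
  case (Suc n)
  then show ?case using val_mult[OF assms, of "x ^ n"] assms by (simp add: algebra_simps)
qed

lemma val_pi_powi: "val S (\<pi> powi n) = n"
  using val_eq[of 1 n] by (simp add: unit_def)

lemma mem_iff_val:
  assumes "x \<noteq> 0"
  shows "x \<in> S \<longleftrightarrow> 0 \<le> val S x"
proof -
  obtain u where u: "unit u" "x = u * \<pi> powi val S x" using assms by (rule valE)
  have "inverse u * (u * \<pi> powi val S x) = \<pi> powi val S x"
    using u(1) by (simp add: unit_def)
  then have "\<pi> powi val S x = inverse u * x"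
    using u(2) by simp
  then have "x \<in> S \<longleftrightarrow> \<pi> powi val S x \<in> S"
    using u unfolding unit_def by (metis mult_mem)
  then show ?thesis by (simp add: pi_powi_mem)
qed

lemma unit_iff_val:
  assumes "x \<noteq> 0"
  shows "unit x \<longleftrightarrow> val S x = 0"
proof -
  have "val S (inverse x) = - val S x"
    using val_mult[of x "inverse x"] val_eq[of 1 0] assms by (simp add: unit_def)
  then show ?thesis
    using assms by (auto simp: unit_def mem_iff_val)
qed

lemma max_ideal_iff: "x \<in> max_ideal S \<longleftrightarrow> x = 0 \<or> 0 < val S x"
proof (cases "x = 0")
  case True
  then show ?thesis unfolding max_ideal_eq by (auto intro: exI[of _ 0])
next
  case False
  have "x \<in> max_ideal S \<longleftrightarrow> x * inverse \<pi> \<in> S"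
    unfolding max_ideal_eq by (auto simp: mult.assoc intro!: exI[of _ "x * inverse \<pi>"])
  also have "\<dots> \<longleftrightarrow> 0 < val S x"
    using False val_mult[of x "inverse \<pi>"] val_pi_powi[of "-1"] by (simp add: mem_iff_val)
  finally show ?thesis using False by simp
qed

lemma max_ideal_mult: "x \<in> max_ideal S \<Longrightarrow> y \<in> S \<Longrightarrow> x * y \<in> max_ideal S"
proof -
  assume "x \<in> max_ideal S" "y \<in> S"
  then obtain s where "s \<in> S" "x = s * \<pi>" unfolding max_ideal_eq by blast
  then have "x * y = (s * y) * \<pi>" "s * y \<in> S" using \<open>y \<in> S\<close> by simp_all
  then show ?thesis unfolding max_ideal_eq by blast
qed

lemma unit_iff_not_max_ideal: "x \<in> S \<Longrightarrow> unit x \<longleftrightarrow> x \<notin> max_ideal S"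
  using unit_iff_val[of x] mem_iff_val[of x] max_ideal_iff[of x] by (cases "x = 0") (auto simp: unit_def)

lemma residue_hom: "ring_hom_cring (sub_ring S) (residue_field S) (residue S)"
  and residue_field_field: "field (residue_field S)"
  and residue_max_ideal: "x \<in> max_ideal S \<Longrightarrow> residue S x = \<zero>\<^bsub>residue_field S\<^esub>"
proof -
  interpret R: cring "sub_ring S" by (rule cring_sub)
  interpret M: maximalideal "max_ideal S" "sub_ring S" by (rule maximal)
  show f: "field (residue_field S)"
    unfolding residue_field_def by (rule M.quotient_is_field[OF cring_sub])
  then interpret F: field "residue_field S" .
  have "residue S = (+>\<^bsub>sub_ring S\<^esub>) (max_ideal S)"
    by (rule ext) (simp add: residue_def)
  then show "ring_hom_cring (sub_ring S) (residue_field S) (residue S)"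
    using M.rcos_ring_hom
    by (intro ring_hom_cringI) (simp_all add: residue_field_def[symmetric] R.cring_axioms F.cring_axioms)
  show "residue S x = \<zero>\<^bsub>residue_field S\<^esub>" if "x \<in> max_ideal S"
    using M.a_rcos_const[OF that] by (simp add: residue_def residue_field_def FactRing_def)
qed

end

lemma subring_of_field_sub_ring:
  assumes "cring (sub_ring S)"
  shows "subring_of_field S"
proof -
  interpret R: cring "sub_ring S" by fact
  show ?thesis
  proof
    show "0 \<in> S" "1 \<in> S"
      using R.zero_closed R.one_closed by simp_all
    show "x + y \<in> S" "x * y \<in> S" if "x \<in> S" "y \<in> S" for x y
      using R.a_closed[of x y] R.m_closed[of x y] that by simp_all
    show "- x \<in> S" if "x \<in> S" for x
    proof -
      have "\<ominus>\<^bsub>sub_ring S\<^esub> x \<in> S" "x + \<ominus>\<^bsub>sub_ring S\<^esub> x = 0"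
        using R.a_inv_closed[of x] R.r_neg[of x] that by simp_all
      then show ?thesis by (metis minus_unique)
    qed
  qed
qed

text \<open>In a principal ideal domain that is not a field, irreducible elements generate maximal
  ideals. There is only one, so all irreducibles are associated to its generator
  \<open>\<pi>\<close>, and factorization into irreducibles becomes a unit times a power of
  \<open>\<pi>\<close>.\<close>

lemma dvr_in_field_of_discrete_valuation_ring:
  assumes "discrete_valuation_ring (sub_ring S)"
    and frac: "\<And>z. \<exists>a\<in>S. \<exists>b\<in>S. b \<noteq> 0 \<and> z = a / b"
  obtains \<pi> where "dvr_in_field S \<pi>"
proof -
  let ?R = "sub_ring S"
  interpret R: principal_domain ?R
    using assms(1) by (simp add: discrete_valuation_ring_def)
  interpret subring_of_field S
    by (rule subring_of_field_sub_ring) (rule R.cring_axioms)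
  define M where "M = max_ideal S"
  have ex1: "\<exists>!M. maximalideal M ?R" and nf: "\<not> field ?R"
    using assms(1) by (auto simp: discrete_valuation_ring_def)
  have M: "maximalideal M ?R"
    unfolding M_def max_ideal_def using ex1 by (rule theI')
  have M_unique: "I = M" if "maximalideal I ?R" for I
    using ex1 M that by blast
  interpret M: maximalideal M ?R by (rule M)
  obtain \<pi> where pi: "\<pi> \<in> S" "M = PIdl\<^bsub>?R\<^esub> \<pi>"
    using R.exists_gen[OF M.is_ideal] by auto
  have M_eq: "M = {s * \<pi> | s. s \<in> S}"
    using pi by (simp add: cgenideal_def)
  have pi_nz: "\<pi> \<noteq> 0"
  proof
    assume "\<pi> = 0"
    then have "M = {0}" unfolding M_eq using zero_mem by (auto intro: exI[of _ 0])
    then have "maximalideal {\<zero>\<^bsub>?R\<^esub>} ?R" using M by simp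
    then show False using R.zeromaximalideal_fieldI nf by blast
  qed
  have inverse_pi: "inverse \<pi> \<notin> S"
  proof
    assume i: "inverse \<pi> \<in> S"
    have "x \<in> M" if "x \<in> S" for x
      unfolding M_eq using mult_mem[OF that i] pi_nz by (intro CollectI exI[of _ "x * inverse \<pi>"]) simp
    then show False using M.I_notcarr M.a_subset by auto
  qed
  define unit where "unit u \<longleftrightarrow> u \<noteq> 0 \<and> u \<in> S \<and> inverse u \<in> S" for u
  have unit_mult: "unit (u * v)" if "unit u" "unit v" for u v
    using that by (simp add: unit_def)
  have UnitsI: "unit u" if "u \<in> S" "v \<in> S" "u * v = 1" for u v
  proof -
    have "inverse u = v" "u \<noteq> 0" using that(3) by (auto intro: inverse_unique)
    then show ?thesis using that by (simp add: unit_def)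
  qed
  have Units_R: "unit u" if "u \<in> Units ?R" for u
    using that UnitsI[of u] by (auto simp: Units_def mult.commute)
  have irr: "\<exists>u. unit u \<and> f = u * \<pi>" if f: "f \<in> S" "f \<noteq> 0" "Divisibility.irreducible (mult_of ?R) f" for f
  proof -
    have "Divisibility.irreducible ?R f"
      using f by (intro R.irreducible_mult_imp_irreducible) auto
    then have "ring_irreducible\<^bsub>?R\<^esub> f" using f by (simp add: ring_irreducible_def)
    then have "maximalideal (PIdl\<^bsub>?R\<^esub> f) ?R"
      using f by (intro R.irreducible_imp_maximalideal) auto
    then have "PIdl\<^bsub>?R\<^esub> f = PIdl\<^bsub>?R\<^esub> \<pi>"
      using M_unique pi(2) by simp
    then have eq: "{s * f | s. s \<in> S} = {s * \<pi> | s. s \<in> S}"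
      by (simp add: cgenideal_def)
    have "1 * f \<in> {s * f | s. s \<in> S}" "1 * \<pi> \<in> {s * \<pi> | s. s \<in> S}"
      by (intro CollectI exI[of _ 1] conjI refl one_mem)+
    then have "f \<in> {s * \<pi> | s. s \<in> S}" "\<pi> \<in> {s * f | s. s \<in> S}"
      unfolding eq by simp_all
    then obtain w v where w: "w \<in> S" "f = w * \<pi>" and v: "v \<in> S" "\<pi> = v * f"
      by blast
    have "w * v * \<pi> = v * f" by (subst w(2)) (simp only: mult_ac)
    also have "\<dots> = 1 * \<pi>" using v(2) by simp
    finally have "w * v = 1" using pi_nz mult_right_cancel by blast
    then show ?thesis using w v UnitsI by blast
  qed
  have fact_S: "\<exists>u n. unit u \<and> x = u * \<pi> ^ n" if x: "x \<in> S" "x \<noteq> 0" for x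
  proof (cases "x \<in> Units ?R")
    case True
    then show ?thesis using Units_R by (intro exI[of _ x] exI[of _ 0]) auto
  next
    case False
    then obtain fs where fs: "set fs \<subseteq> carrier (mult_of ?R)" "wfactors (mult_of ?R) fs x"
      using R.factorization_property[of x] x by auto
    have "\<exists>u n. unit u \<and> foldr (*) gs 1 = u * \<pi> ^ n"
      if "set gs \<subseteq> carrier (mult_of ?R)" "\<forall>g\<in>set gs. Divisibility.irreducible (mult_of ?R) g" for gs
      using that
    proof (induction gs)
      case Nil
      show ?case by (intro exI[of _ 1] exI[of _ 0]) (simp add: unit_def)
    next
      case (Cons g gs)
      then obtain u n where un: "unit u" "foldr (*) gs 1 = u * \<pi> ^ n" by auto
      obtain v where v: "unit v" "g = v * \<pi>" using irr[of g] Cons.prems by auto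
      show ?case
        using un v by (intro exI[of _ "v * u"] exI[of _ "Suc n"]) (simp add: unit_mult)
    qed
    moreover have "set fs \<subseteq> carrier (mult_of ?R)" "\<forall>g\<in>set fs. Divisibility.irreducible (mult_of ?R) g"
      using fs by (auto simp: wfactors_def)
    ultimately obtain u n where un: "unit u" "foldr (*) fs 1 = u * \<pi> ^ n"
      by blast
    have mult_R: "(\<otimes>\<^bsub>?R\<^esub>) = (*)" by (intro ext) simp
    \<comment> \<open>\<open>wfactors\<close> gives the product only up to association; the unit
      \<open>c\<close> found below makes it an equality.\<close>
    have "foldr (\<otimes>\<^bsub>mult_of ?R\<^esub>) fs \<one>\<^bsub>mult_of ?R\<^esub> \<sim>\<^bsub>mult_of ?R\<^esub> x"
      using fs(2) unfolding wfactors_def by blast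
    then have "foldr (*) fs 1 \<sim>\<^bsub>mult_of ?R\<^esub> x"
      unfolding mult_mult_of one_mult_of mult_R by simp
    then have "\<exists>c\<in>S. x = foldr (*) fs 1 * c" "\<exists>c\<in>S. foldr (*) fs 1 = x * c"
      unfolding associated_def factor_def by auto
    then obtain c c' where c: "c \<in> S" "c' \<in> S" "x = foldr (*) fs 1 * c" "foldr (*) fs 1 = x * c'"
      by blast
    have "x * (c * c') = x * c' * c" by (simp only: mult_ac)
    also have "\<dots> = x * 1" unfolding c(4)[symmetric] using c(3) by simp
    finally have "x * (c * c') = x * 1" .
    then have "c * c' = 1" using x mult_left_cancel by blast
    then have "unit c" using c UnitsI by blast
    then show ?thesis
      using un c(3) by (intro exI[of _ "u * c"] exI[of _ n]) (simp add: unit_mult mult_ac)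
  qed
  have "\<exists>u n. u \<noteq> 0 \<and> u \<in> S \<and> inverse u \<in> S \<and> x = u * \<pi> powi n" if x: "x \<noteq> 0" for x
  proof -
    obtain a b where ab: "a \<in> S" "b \<in> S" "b \<noteq> 0" "x = a / b" using frac by blast
    then have "a \<noteq> 0" using x by auto
    obtain u n where u: "unit u" "a = u * \<pi> ^ n" using fact_S ab(1) \<open>a \<noteq> 0\<close> by blast
    obtain v m where v: "unit v" "b = v * \<pi> ^ m" using fact_S ab(2,3) by blast
    have "x = (u * inverse v) * \<pi> powi (int n - int m)"
      using v pi_nz by (simp add: ab(4) u power_int_diff unit_def field_simps)
    moreover have "unit (u * inverse v)" using u v by (intro unit_mult) (auto simp: unit_def)
    ultimately show ?thesis unfolding unit_def by blast
  qed
  note factorization = this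
  have "dvr_in_field S \<pi>"
  proof (intro dvr_in_field.intro dvr_in_field_axioms.intro)
    show "max_ideal S = {s * \<pi> | s. s \<in> S}" "maximalideal (max_ideal S) (sub_ring S)"
      using M_eq M by (simp_all only: M_def)
  qed (fact subring_of_field_axioms pi(1) pi_nz inverse_pi factorization R.cring_axioms)+
  then show ?thesis by (rule that)
qed

section \<open>Reduction types and semi-stability\<close>

lemma coeff_mult_top:
  fixes u f :: "'a::comm_ring_1 poly"
  assumes "Polynomial.degree u \<le> m" "Polynomial.degree f \<le> n"
  shows "Polynomial.coeff (u * f) (m + n) = Polynomial.coeff u m * Polynomial.coeff f n"
proof -
  have "Polynomial.coeff (u * f) (m + n) =
      (\<Sum>i\<le>m+n. if i = m then Polynomial.coeff u m * Polynomial.coeff f n else 0)"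
    unfolding coeff_mult
  proof (rule sum.cong)
    fix i assume "i \<in> {..m + n}"
    then show "Polynomial.coeff u i * Polynomial.coeff f (m + n - i) =
        (if i = m then Polynomial.coeff u m * Polynomial.coeff f n else 0)"
      using assms by (cases i m rule: linorder_cases) (auto simp: coeff_eq_0)
  qed simp
  then show ?thesis by simp
qed

lemma form_resultant_zero_model:
  assumes "0 < d" "\<And>i. i \<le> d \<Longrightarrow> a i = 0 \<and> b i = 0"
  shows "form_resultant d (a, b) = 0"
proof -
  have "form_resultant d (a, b) = form_resultant d (\<lambda>i. 0 * a i, \<lambda>i. 0 * b i)"
    using assms(2) by (intro form_resultant_cong) auto
  also have "\<dots> = 0"
    using assms(1) unfolding form_resultant_scale by simp
  finally show ?thesis .
qed

section \<open>Normalized models and the exponent of the resultant\<close>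

definition nonzero_coords :: "nat \<Rightarrow> 'k::field_char_0 form \<Rightarrow> 'k form \<Rightarrow> 'k set" where
  "nonzero_coords d a b = a ` {..d} \<union> b ` {..d} - {0}"

lemma finite_nonzero_coords: "finite (nonzero_coords d a b)"
  by (simp add: nonzero_coords_def)

text \<open>Guarantees that the \<open>Min\<close> in \<open>min_val\<close> is taken over a
  nonempty set.\<close>

lemma nonzero_coords_nonempty:
  assumes "0 < d" "form_resultant d (a, b) \<noteq> 0"
  shows "nonzero_coords d a b \<noteq> {}"
proof
  assume "nonzero_coords d a b = {}"
  then have "a i = 0 \<and> b i = 0" if "i \<le> d" for i
    using that unfolding nonzero_coords_def by blast
  then show False
    using form_resultant_zero_model assms by blast
qed

lemma nonzero_coords_scale:
  assumes "c \<noteq> 0"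
  shows "nonzero_coords d (\<lambda>i. c * a i) (\<lambda>i. c * b i) = (*) c ` nonzero_coords d a b"
  using assms unfolding nonzero_coords_def by auto

context dvr_in_field
begin

lemma min_val_eq: "min_val S d (a, b) = Min (val S ` nonzero_coords d a b)"
  by (simp add: nonzero_coords_def)

lemma min_val_scale:
  assumes "c \<noteq> 0" "nonzero_coords d a b \<noteq> {}"
  shows "min_val S d (\<lambda>i. c * a i, \<lambda>i. c * b i) = val S c + min_val S d (a, b)"
proof -
  have "val S ` nonzero_coords d (\<lambda>i. c * a i) (\<lambda>i. c * b i) =
      (\<lambda>n. val S c + n) ` (val S ` nonzero_coords d a b)"
    unfolding nonzero_coords_scale[OF assms(1)] image_image
    using assms(1) by (intro image_cong) (auto simp: val_mult nonzero_coords_def)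
  moreover have "mono (\<lambda>n. val S c + n)"
    by (simp add: mono_def)
  ultimately show ?thesis
    unfolding min_val_eq using assms(2) finite_nonzero_coords[of d a b]
    by (simp add: mono_Min_commute)
qed

lemma integral_iff_min_val:
  assumes "nonzero_coords d a b \<noteq> {}"
  shows "(\<forall>i\<le>d. a i \<in> S \<and> b i \<in> S) \<longleftrightarrow> 0 \<le> min_val S d (a, b)"
proof -
  have "0 \<le> min_val S d (a, b) \<longleftrightarrow> (\<forall>x\<in>nonzero_coords d a b. 0 \<le> val S x)"
    unfolding min_val_eq using assms finite_nonzero_coords[of d a b] by simp
  also have "\<dots> \<longleftrightarrow> (\<forall>x\<in>nonzero_coords d a b. x \<in> S)"
    using mem_iff_val by (auto simp: nonzero_coords_def)
  also have "\<dots> \<longleftrightarrow> (\<forall>i\<le>d. a i \<in> S \<and> b i \<in> S)"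
  proof -
    have "(\<forall>x\<in>(Y - {0}). x \<in> S) \<longleftrightarrow> (\<forall>x\<in>Y. x \<in> S)" for Y :: "'k set"
      using zero_mem by auto
    then show ?thesis unfolding nonzero_coords_def by auto
  qed
  finally show ?thesis ..
qed

text \<open>All \<open>2 * d\<close> rows of the Sylvester matrix gain the factor \<open>c\<close>,
  which cancels the shift of the minimum.\<close>

lemma resultant_exponent_scale:
  assumes "0 < d" "c \<noteq> 0" "form_resultant d (a, b) \<noteq> 0"
  shows "resultant_exponent S d (\<lambda>i. c * a i, \<lambda>i. c * b i) = resultant_exponent S d (a, b)"
  using assms unfolding resultant_exponent_def form_resultant_scale
  by (simp add: val_mult val_power min_val_scale nonzero_coords_nonempty algebra_simps
      del: min_val.simps form_resultant.simps)

text \<open>Scaling by the power of \<open>\<pi>\<close> opposite to the minimal valuation turns the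
  exponent into the plain valuation of an element of \<open>S\<close>.\<close>

lemma normalized_model:
  assumes "0 < d" "form_resultant d (a, b) \<noteq> 0"
  obtains c where "c \<noteq> 0" "min_val S d (\<lambda>i. c * a i, \<lambda>i. c * b i) = 0"
    "form_resultant d (\<lambda>i. c * a i, \<lambda>i. c * b i) \<noteq> 0"
    "\<And>i. i \<le> d \<Longrightarrow> c * a i \<in> S \<and> c * b i \<in> S"
    "val S (form_resultant d (\<lambda>i. c * a i, \<lambda>i. c * b i)) = resultant_exponent S d (a, b)"
proof -
  define c where "c = \<pi> powi (- min_val S d (a, b))"
  have c: "c \<noteq> 0" "val S c = - min_val S d (a, b)"
    unfolding c_def by (simp_all add: val_pi_powi del: min_val.simps)
  have min: "min_val S d (\<lambda>i. c * a i, \<lambda>i. c * b i) = 0"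
    using min_val_scale[OF c(1) nonzero_coords_nonempty[OF assms]] c(2) by simp
  have res: "form_resultant d (\<lambda>i. c * a i, \<lambda>i. c * b i) \<noteq> 0"
    unfolding form_resultant_scale using assms c(1) by simp
  have "\<forall>i\<le>d. c * a i \<in> S \<and> c * b i \<in> S"
    using integral_iff_min_val[OF nonzero_coords_nonempty[OF assms(1) res]] min by simp
  moreover have "val S (form_resultant d (\<lambda>i. c * a i, \<lambda>i. c * b i)) = resultant_exponent S d (a, b)"
    using resultant_exponent_scale[OF assms(1) c(1) assms(2)] min
    unfolding resultant_exponent_def by simp
  ultimately show ?thesis
    using that c(1) min res by blast
qed

lemma resultant_exponent_nonneg:
  assumes "0 < d" "form_resultant d (a, b) \<noteq> 0"
  shows "0 \<le> resultant_exponent S d (a, b)"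
proof -
  obtain c where c: "form_resultant d (\<lambda>i. c * a i, \<lambda>i. c * b i) \<noteq> 0"
    "\<And>i. i \<le> d \<Longrightarrow> c * a i \<in> S \<and> c * b i \<in> S"
    "val S (form_resultant d (\<lambda>i. c * a i, \<lambda>i. c * b i)) = resultant_exponent S d (a, b)"
    using normalized_model[OF assms] by blast
  have "form_resultant d (\<lambda>i. c * a i, \<lambda>i. c * b i) \<in> S"
    using c(2) by (intro form_resultant_mem) auto
  then show ?thesis
    using mem_iff_val[OF c(1)] c(3) by simp
qed

text \<open>The resultant has valuation 0 and the minimum is nonnegative by integrality, so the
  exponent is at most 0; it is also nonnegative.\<close>

lemma resultant_exponent_zero_of_spanning:
  assumes "0 < d" "\<And>i. i \<le> d \<Longrightarrow> a i \<in> S \<and> b i \<in> S"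
    and "spanning d (form_poly d a) (form_poly d b)"
  shows "resultant_exponent S d (a, b) = 0"
proof -
  have res: "form_resultant d (a, b) \<noteq> 0" "unit (form_resultant d (a, b))"
    using spanning_imp_unit_resultant[OF assms(3)] form_resultant_mem[of d a b] assms(2)
    by (auto simp: unit_def)
  have "val S (form_resultant d (a, b)) = 0"
    using res unit_iff_val by blast
  moreover have "0 \<le> min_val S d (a, b)"
    using integral_iff_min_val[OF nonzero_coords_nonempty[OF assms(1) res(1)]] assms(2) by blast
  then have "0 \<le> 2 * int d * min_val S d (a, b)"
    using assms(1) by simp
  moreover note resultant_exponent_nonneg[OF assms(1) res(1)]
  ultimately show ?thesis
    unfolding resultant_exponent_def by linarith
qed

lemma spanning_of_resultant_exponent_zero:
  assumes "0 < d" "form_resultant d (a, b) \<noteq> 0" "resultant_exponent S d (a, b) = 0"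
  obtains c where "c \<noteq> 0" "\<And>i. i \<le> d \<Longrightarrow> c * a i \<in> S \<and> c * b i \<in> S"
    "spanning d (form_poly d (\<lambda>i. c * a i)) (form_poly d (\<lambda>i. c * b i))"
proof -
  obtain c where c: "c \<noteq> 0" "form_resultant d (\<lambda>i. c * a i, \<lambda>i. c * b i) \<noteq> 0"
    "\<And>i. i \<le> d \<Longrightarrow> c * a i \<in> S \<and> c * b i \<in> S"
    "val S (form_resultant d (\<lambda>i. c * a i, \<lambda>i. c * b i)) = 0"
    using normalized_model[OF assms(1,2)] assms(3) by metis
  then have "unit (form_resultant d (\<lambda>i. c * a i, \<lambda>i. c * b i))"
    using unit_iff_val by blast
  then have "spanning d (form_poly d (\<lambda>i. c * a i)) (form_poly d (\<lambda>i. c * b i))"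
    using c(2,3) assms(1) by (intro unit_resultant_imp_spanning) (auto simp: unit_def)
  then show ?thesis using that c by blast
qed

lemma resultant_exponent_cong:
  assumes "\<And>i. i \<le> d \<Longrightarrow> a i = a' i \<and> b i = b' i"
  shows "resultant_exponent S d (a, b) = resultant_exponent S d (a', b')"
proof -
  have "nonzero_coords d a b = nonzero_coords d a' b'"
    unfolding nonzero_coords_def using assms by auto
  then show ?thesis
    using form_resultant_cong[of d a a' b b'] assms
    unfolding resultant_exponent_def min_val_eq by simp
qed

section \<open>Smith normal form of 2 by 2 matrices over the valuation ring\<close>

definition special :: "'k matrix2 \<Rightarrow> bool" where
  "special \<Gamma> \<longleftrightarrow> (case \<Gamma> of (\<alpha>, \<beta>, \<gamma>, \<delta>) \<Rightarrow> {\<alpha>, \<beta>, \<gamma>, \<delta>} \<subseteq> S) \<and> det2 \<Gamma> = 1"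

lemma special_mult: "special \<Gamma> \<Longrightarrow> special \<Delta> \<Longrightarrow> special (matrix2_mult \<Gamma> \<Delta>)"
  using det2_mult[of \<Gamma> \<Delta>] by (cases \<Gamma>; cases \<Delta>) (auto simp: special_def)

lemma special_inv2: "special \<Gamma> \<Longrightarrow> special (inv2 \<Gamma>)"
  by (cases \<Gamma>) (auto simp: special_def algebra_simps)

text \<open>The scalar \<open>l\<close> may lie outside \<open>S\<close>: it takes the pole of the
  matrix, leaving the diagonal matrix of \<open>t\<close> and 1.\<close>

definition smith_decomposable :: "'k matrix2 \<Rightarrow> bool" where
  "smith_decomposable \<Gamma> \<longleftrightarrow> (\<exists>l t U W. l \<noteq> 0 \<and> t \<in> S \<and> t \<noteq> 0 \<and> special U \<and> special W \<and>
     \<Gamma> = matrix2_mult U (matrix2_mult (l * t, 0, 0, l) W))"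

text \<open>Gauss elimination with pivot \<open>\<delta>\<close>, which divides every entry:
  unipotent matrices clear \<beta> from the left and \<gamma> from the right. The remaining diagonal
  entry is the Schur complement \<alpha> - \<beta>\<gamma>/\<delta>.\<close>

lemma smith_decomposable_pivot:
  assumes "\<delta> \<noteq> 0" "\<alpha> / \<delta> \<in> S" "\<beta> / \<delta> \<in> S" "\<gamma> / \<delta> \<in> S" "\<alpha> * \<delta> - \<beta> * \<gamma> \<noteq> 0"
  shows "smith_decomposable (\<alpha>, \<beta>, \<gamma>, \<delta>)"
  unfolding smith_decomposable_def
proof (intro exI conjI)
  let ?t = "\<alpha> / \<delta> - (\<beta> / \<delta>) * (\<gamma> / \<delta>)"
  show "\<delta> \<noteq> 0" by fact
  show "?t \<in> S" using assms by (intro diff_mem mult_mem)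
  show "?t \<noteq> 0" using assms(1,5) by (simp add: field_simps)
  show "special (1, \<beta> / \<delta>, 0, 1)" "special (1, 0, \<gamma> / \<delta>, 1)"
    using assms by (simp_all add: special_def)
  show "(\<alpha>, \<beta>, \<gamma>, \<delta>) =
      matrix2_mult (1, \<beta> / \<delta>, 0, 1) (matrix2_mult (\<delta> * ?t, 0, 0, \<delta>) (1, 0, \<gamma> / \<delta>, 1))"
    using assms(1) by (simp add: field_simps)
qed

lemma smith_decomposable_mult:
  assumes "special U" "special W" "smith_decomposable (matrix2_mult U (matrix2_mult \<Gamma> W))"
  shows "smith_decomposable \<Gamma>"
proof -
  obtain l t U' W' where *: "l \<noteq> 0" "t \<in> S" "t \<noteq> 0" "special U'" "special W'"
    "matrix2_mult U (matrix2_mult \<Gamma> W) = matrix2_mult U' (matrix2_mult (l * t, 0, 0, l) W')"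
    using assms(3) unfolding smith_decomposable_def by blast
  have one: "matrix2_mult (1, 0, 0, 1) A = A" "matrix2_mult A (1, 0, 0, 1) = A" for A :: "'k matrix2"
    by (cases A; simp)+
  have inv: "matrix2_mult A (inv2 A) = (1, 0, 0, 1)" "matrix2_mult (inv2 A) A = (1, 0, 0, 1)"
    if "special A" for A
    using that by (cases A; simp add: special_def algebra_simps)+
  have "\<Gamma> = matrix2_mult (inv2 U) (matrix2_mult (matrix2_mult U (matrix2_mult \<Gamma> W)) (inv2 W))"
    by (simp only: matrix2_mult_assoc inv[OF assms(2)] one)
      (simp only: matrix2_mult_assoc[symmetric] inv[OF assms(1)] one)
  also have "\<dots> = matrix2_mult (matrix2_mult (inv2 U) U') (matrix2_mult (l * t, 0, 0, l) (matrix2_mult W' (inv2 W)))"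
    unfolding *(6) by (simp only: matrix2_mult_assoc)
  finally show ?thesis
    unfolding smith_decomposable_def
    using *(1-5) assms(1,2) special_mult special_inv2
    by (intro exI[of _ l] exI[of _ t] exI[of _ "matrix2_mult (inv2 U) U'"] exI[of _ "matrix2_mult W' (inv2 W)"]) simp
qed

text \<open>An entry of least valuation divides all others; it is moved to the lower right corner to
  serve as pivot.\<close>

lemma smith_decomposable:
  assumes "det2 \<Gamma> \<noteq> 0"
  shows "smith_decomposable \<Gamma>"
proof -
  obtain \<alpha> \<beta> \<gamma> \<delta> where \<Gamma>: "\<Gamma> = (\<alpha>, \<beta>, \<gamma>, \<delta>)"
    by (cases \<Gamma>)
  have det: "\<alpha> * \<delta> - \<beta> * \<gamma> \<noteq> 0"
    using assms by (simp add: \<Gamma>)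
  let ?E = "{\<alpha>, \<beta>, \<gamma>, \<delta>} - {0}"
  have "?E \<noteq> {}" using det by auto
  then obtain e where e: "e \<in> ?E" "\<And>x. x \<in> ?E \<Longrightarrow> val S e \<le> val S x"
    using finite_has_minimal[of "val S ` ?E"]
    by (smt (verit, ccfv_threshold) finite.emptyI finite.insertI finite_Diff finite_imageI imageE imageI image_is_empty)
  have "e \<noteq> 0" using e(1) by simp
  have div: "x / e \<in> S" if "x \<in> {\<alpha>, \<beta>, \<gamma>, \<delta>}" for x
  proof (cases "x = 0")
    case False
    then have "val S e \<le> val S x" using e(2) that by blast
    moreover have "val S ((x / e) * e) = val S (x / e) + val S e"
      using False \<open>e \<noteq> 0\<close> by (intro val_mult) auto
    ultimately have "0 \<le> val S (x / e)" using \<open>e \<noteq> 0\<close> by simp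
    then show ?thesis using False \<open>e \<noteq> 0\<close> by (simp add: mem_iff_val)
  qed simp
  have ndiv: "- x / e \<in> S" if "x \<in> {\<alpha>, \<beta>, \<gamma>, \<delta>}" for x
    using uminus_mem[OF div[OF that]] by simp
  \<comment> \<open>The signed swap: from the left it exchanges rows, from the right columns. The
    sign keeps the determinant equal to 1.\<close>
  have J: "special (0, 1, - 1, 0)" "special (1, 0, 0, 1)"
    by (simp_all add: special_def)
  from e(1) consider "e = \<delta>" | "e = \<gamma>" | "e = \<beta>" | "e = \<alpha>" by blast
  then show ?thesis
  proof cases
    case 1
    then show ?thesis
      unfolding \<Gamma> using div \<open>e \<noteq> 0\<close> det by (intro smith_decomposable_pivot) auto
  next
    case 2
    have "smith_decomposable (- \<beta>, \<alpha>, - \<delta>, \<gamma>)"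
      using div ndiv \<open>e \<noteq> 0\<close> det 2 by (intro smith_decomposable_pivot) (auto simp: algebra_simps)
    then show ?thesis
      using smith_decomposable_mult[OF J(2) J(1), of \<Gamma>] unfolding \<Gamma> by simp
  next
    case 3
    have "\<beta> / e \<in> S" "\<alpha> / e \<in> S" "\<gamma> / e \<in> S" "\<delta> / e \<in> S" using div by auto
    then have "smith_decomposable (\<gamma>, \<delta>, - \<alpha>, - \<beta>)"
      using \<open>e \<noteq> 0\<close> det 3 by (intro smith_decomposable_pivot) (auto simp: algebra_simps)
    then show ?thesis
      using smith_decomposable_mult[OF J(1) J(2), of \<Gamma>] unfolding \<Gamma> by simp
  next
    case 4
    have "\<beta> / e \<in> S" "\<alpha> / e \<in> S" "\<gamma> / e \<in> S" "\<delta> / e \<in> S" using div by auto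
    then have "smith_decomposable (- \<delta>, \<gamma>, \<beta>, - \<alpha>)"
      using \<open>e \<noteq> 0\<close> det 4 by (intro smith_decomposable_pivot) (auto simp: algebra_simps)
    then show ?thesis
      using smith_decomposable_mult[OF J(1) J(1), of \<Gamma>] unfolding \<Gamma> by simp
  qed
qed

section \<open>Conjugation over the valuation ring and its reduction\<close>

lemma spanning_special:
  assumes "0 < d" "special \<Gamma>" "Polynomial.degree f \<le> d" "Polynomial.degree g \<le> d" "spanning d f g"
  shows "spanning d (fst (poly_conj d \<Gamma> (f, g))) (snd (poly_conj d \<Gamma> (f, g)))"
  using assms by (cases \<Gamma>) (auto simp: special_def intro!: spanning_poly_conj simp del: poly_conj.simps)

lemma polys_over_special:
  assumes "special \<Gamma>" "f \<in> polys_over" "g \<in> polys_over"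
  shows "fst (poly_conj d \<Gamma> (f, g)) \<in> polys_over" "snd (poly_conj d \<Gamma> (f, g)) \<in> polys_over"
  using assms by (cases \<Gamma>; auto simp: special_def intro!: polys_over_poly_conj simp del: poly_conj.simps)+

text \<open>Write Y^(2d-1) as a combination of \<open>f\<close> and \<open>g\<close>. Its top
  coefficient 1 involves only the top coefficients of \<open>f\<close> and \<open>g\<close>, which
  therefore cannot both lie in the maximal ideal. Geometrically, the reduction has no common zero at
  [0:1].\<close>

lemma spanning_top_unit:
  assumes "0 < d" "Polynomial.degree f \<le> d" "Polynomial.degree g \<le> d" "f \<in> polys_over" "g \<in> polys_over"
    and "spanning d f g"
  shows "unit (Polynomial.coeff f d) \<or> unit (Polynomial.coeff g d)"
proof (rule ccontr)
  assume "\<not> ?thesis"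
  then have fg: "Polynomial.coeff f d \<in> max_ideal S" "Polynomial.coeff g d \<in> max_ideal S"
    using assms(4,5) unit_iff_not_max_ideal by (auto simp: polys_over_def)
  have "Polynomial.degree (Polynomial.monom (1::'k) (2 * d - 1)) < 2 * d"
    using assms(1) by (simp add: degree_monom_eq)
  then obtain u v where uv: "u \<in> polys_over" "v \<in> polys_over" "Polynomial.degree u < d" "Polynomial.degree v < d"
    "Polynomial.monom 1 (2 * d - 1) = u * f + v * g"
    using assms(6) polys_over_monom[OF one_mem, of "2 * d - 1"] unfolding spanning_def by blast
  have n: "2 * d - 1 = (d - 1) + d" using assms(1) by simp
  have "1 = Polynomial.coeff (u * f + v * g) ((d - 1) + d)"
    unfolding uv(5)[symmetric] n by simp
  also have "\<dots> = Polynomial.coeff f d * Polynomial.coeff u (d - 1) + Polynomial.coeff g d * Polynomial.coeff v (d - 1)"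
    unfolding coeff_add using uv(3,4) assms(2,3) by (subst (1 2) coeff_mult_top) (auto simp: mult.commute)
  finally have one: "1 = Polynomial.coeff f d * Polynomial.coeff u (d - 1) + Polynomial.coeff g d * Polynomial.coeff v (d - 1)" .
  obtain r s where rs: "r \<in> S" "s \<in> S" "Polynomial.coeff f d = r * \<pi>" "Polynomial.coeff g d = s * \<pi>"
    using fg unfolding max_ideal_eq by blast
  have "1 = (r * Polynomial.coeff u (d - 1) + s * Polynomial.coeff v (d - 1)) * \<pi>"
    using one unfolding rs by (simp add: algebra_simps)
  moreover have "(r * Polynomial.coeff u (d - 1) + s * Polynomial.coeff v (d - 1)) \<in> S"
    using rs uv(1,2) by (auto simp: polys_over_def)
  ultimately have "1 \<in> max_ideal S" unfolding max_ideal_eq by blast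
  then show False
    using unit_iff_not_max_ideal[OF one_mem] by (simp add: unit_def)
qed

text \<open>
  The inclusion of \<open>S\<close> into the field and the reduction map are both ring homomorphisms, so that
  conjugation over the field by a matrix over \<open>S\<close> reduces to conjugation over the residue field.
\<close>

lemma unstable_reduction:
  assumes AB: "\<And>i. i \<le> d \<Longrightarrow> A i \<in> S \<and> B i \<in> S" and \<Gamma>: "special \<Gamma>"
    and fg: "poly_conj d \<Gamma> (form_poly d A, form_poly d B) = (f, g)"
    and f: "\<And>i. i \<le> d \<Longrightarrow> real i \<le> (real d - 1) / 2 \<Longrightarrow> Polynomial.coeff f i \<in> max_ideal S"
    and g: "\<And>i. i \<le> d \<Longrightarrow> real i \<le> (real d + 1) / 2 \<Longrightarrow> Polynomial.coeff g i \<in> max_ideal S"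
  shows "unstable (residue_field S) d (\<lambda>i. residue S (A i), \<lambda>i. residue S (B i))"
proof -
  let ?F = "residue_field S"
  let ?L = "field.alg_closure ?F"
  obtain \<alpha> \<beta> \<gamma> \<delta> where \<Gamma>_eq: "\<Gamma> = (\<alpha>, \<beta>, \<gamma>, \<delta>)"
    by (cases \<Gamma>)
  have mem: "{\<alpha>, \<beta>, \<gamma>, \<delta>} \<subseteq> S" and det: "\<alpha> * \<delta> - \<beta> * \<gamma> = 1"
    using \<Gamma> by (auto simp: \<Gamma>_eq special_def)
  interpret F: field ?F by (rule residue_field_field)
  define i :: "'k set \<Rightarrow> ('k set list \<times> nat) multiset \<Rightarrow> 'k set" where "i = ring.indexed_const ?F"
  interpret L: algebraic_closure ?L "ring.indexed_const ?F ` carrier ?F"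
    by (rule F.alg_closureE)
  have i_hom: "i \<in> Ring.ring_hom ?F ?L"
    unfolding i_def by (rule F.alg_closureE)
  interpret R: cring "sub_ring S" by (rule cring_sub)
  interpret res: ring_hom_cring "sub_ring S" ?F "residue S" by (rule residue_hom)
  \<comment> \<open>Reduction to the residue field followed by the embedding into its algebraic
    closure.\<close>
  define h where "h x = i (residue S x)" for x
  have h_hom: "ring_hom_cring (sub_ring S) ?L h"
    unfolding h_def
    by (rule ring_hom_cringI[OF R.cring_axioms L.cring_axioms])
       (use ring_hom_trans[OF res.homh i_hom] in \<open>simp add: o_def\<close>)
  interpret h: ring_hom_cring "sub_ring S" ?L h by (rule h_hom)
  have incl_hom: "ring_hom_cring (sub_ring S) base_field (\<lambda>x. x)"
    by (rule ring_hom_cringI[OF R.cring_axioms cring_from_type_algebra]) (auto simp: Ring.ring_hom_def)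
  interpret incl: ring_hom_cring "sub_ring S" base_field "\<lambda>x. x" by (rule incl_hom)
  have mem': "{\<alpha>, \<beta>, \<gamma>, \<delta>} \<subseteq> carrier (sub_ring S)" using mem by simp
  have AB': "A i \<in> carrier (sub_ring S)" "B i \<in> carrier (sub_ring S)" if "i \<le> d" for i
    using AB that by auto
  let ?C = "conj_model (sub_ring S) d \<Gamma> (A, B)"
  have "?C = conj_model base_field d \<Gamma> (A, B)"
    using incl.conj_model_hom(1)[OF mem' AB'] unfolding \<Gamma>_eq by (simp add: prod.map_ident_strong del: conj_model.simps)
  then have C: "?C = (Polynomial.coeff f, Polynomial.coeff g)"
    unfolding conj_model_base_field fg by simp
  have "conj_model ?L d (h \<alpha>, h \<beta>, h \<gamma>, h \<delta>) (\<lambda>i. h (A i), \<lambda>i. h (B i)) =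
      (\<lambda>i. h (Polynomial.coeff f i), \<lambda>i. h (Polynomial.coeff g i))"
    using h.conj_model_hom(1)[OF mem' AB'] C unfolding \<Gamma>_eq by (simp del: conj_model.simps)
  note conj = this
  have zero: "h x = \<zero>\<^bsub>?L\<^esub>" if "x \<in> max_ideal S" for x
    unfolding h_def residue_max_ideal[OF that]
    using ring_hom_zero[OF i_hom F.ring_axioms L.ring_axioms] .
  have sl: "SL2 ?L (h \<alpha>, h \<beta>, h \<gamma>, h \<delta>)"
  proof -
    \<comment> \<open>The determinant condition is transported as an identity of sums and products;
      the difference is restored in the target ring.\<close>
    have "\<alpha> * \<delta> = 1 + \<beta> * \<gamma>"
      using det by (simp add: algebra_simps)
    then have "h (\<alpha> * \<delta>) = h (1 + \<beta> * \<gamma>)" by simp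
    moreover have "h (\<alpha> * \<delta>) = h \<alpha> \<otimes>\<^bsub>?L\<^esub> h \<delta>" "h (\<beta> * \<gamma>) = h \<beta> \<otimes>\<^bsub>?L\<^esub> h \<gamma>"
      using h.hom_mult[of \<alpha> \<delta>] h.hom_mult[of \<beta> \<gamma>] mem by simp_all
    moreover have "h (1 + \<beta> * \<gamma>) = \<one>\<^bsub>?L\<^esub> \<oplus>\<^bsub>?L\<^esub> h (\<beta> * \<gamma>)"
      using h.hom_add[of 1 "\<beta> * \<gamma>"] h.hom_one mem by simp
    ultimately have "h \<alpha> \<otimes>\<^bsub>?L\<^esub> h \<delta> = \<one>\<^bsub>?L\<^esub> \<oplus>\<^bsub>?L\<^esub> h \<beta> \<otimes>\<^bsub>?L\<^esub> h \<gamma>"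
      by simp
    moreover have hc: "{h \<alpha>, h \<beta>, h \<gamma>, h \<delta>} \<subseteq> carrier ?L"
      using mem' h.hom_closed by blast
    ultimately have "h \<alpha> \<otimes>\<^bsub>?L\<^esub> h \<delta> \<ominus>\<^bsub>?L\<^esub> h \<beta> \<otimes>\<^bsub>?L\<^esub> h \<gamma> = \<one>\<^bsub>?L\<^esub>"
      by (simp add: L.minus_eq L.a_assoc L.r_neg)
    with hc show ?thesis by simp
  qed
  have fz: "\<forall>i\<le>d. real i \<le> (real d - 1) / 2 \<longrightarrow> h (Polynomial.coeff f i) = \<zero>\<^bsub>?L\<^esub>"
    and gz: "\<forall>j\<le>d. real j \<le> (real d + 1) / 2 \<longrightarrow> h (Polynomial.coeff g j) = \<zero>\<^bsub>?L\<^esub>"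
    using f g zero by blast+
  have "\<exists>\<Gamma> a' b'. SL2 ?L \<Gamma> \<and> conj_model ?L d \<Gamma> (\<lambda>i. h (A i), \<lambda>i. h (B i)) = (a', b') \<and>
      (\<forall>i\<le>d. real i \<le> (real d - 1) / 2 \<longrightarrow> a' i = \<zero>\<^bsub>?L\<^esub>) \<and>
      (\<forall>j\<le>d. real j \<le> (real d + 1) / 2 \<longrightarrow> b' j = \<zero>\<^bsub>?L\<^esub>)"
    by (intro exI conjI, rule sl, rule conj, rule fz, rule gz)
  then show ?thesis
    unfolding unstable.simps h_def i_def .
qed

text \<open>Here \<open>(a, b)\<close> is the model over \<open>S\<close> with unit resultant and
  \<open>(a', b')\<close> the semi-stable one; \<open>k\<close> absorbs the choice of
  models.\<close>

lemma semistable_conjugate: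
  assumes d: "1 < d"
    and ab: "\<And>i. i \<le> d \<Longrightarrow> a i \<in> S \<and> b i \<in> S" "spanning d (form_poly d a) (form_poly d b)"
    and \<Gamma>: "det2 \<Gamma> \<noteq> 0" and k: "k \<noteq> 0"
    and conj: "(form_poly d a', form_poly d b') =
      map_prod (Polynomial.smult k) (Polynomial.smult k) (poly_conj d \<Gamma> (form_poly d a, form_poly d b))"
    and semistable: "semistable_reduction S d (a', b')"
    and res: "form_resultant d (a', b') \<noteq> 0"
  shows "resultant_exponent S d (a', b') = 0"
proof -
  have d0: "0 < d" using d by simp
  obtain l t U W where l: "l \<noteq> 0" and t: "t \<in> S" "t \<noteq> 0" and UW: "special U" "special W"
    and \<Gamma>_eq: "\<Gamma> = matrix2_mult U (matrix2_mult (l * t, 0, 0, l) W)"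
    using smith_decomposable[OF \<Gamma>] unfolding smith_decomposable_def by blast
  obtain f g where fg: "poly_conj d U (form_poly d a, form_poly d b) = (f, g)"
    by (cases "poly_conj d U (form_poly d a, form_poly d b)")
  have ab_poly: "form_poly d a \<in> polys_over" "form_poly d b \<in> polys_over"
    using ab(1) by (auto intro!: polys_over_form_poly)
  have fg_over: "f \<in> polys_over" "g \<in> polys_over"
    using polys_over_special[OF UW(1) ab_poly, of d] by (simp_all add: fg)
  have fg_deg: "Polynomial.degree f \<le> d" "Polynomial.degree g \<le> d"
    using degree_poly_conj[of d U "(form_poly d a, form_poly d b)"] by (simp_all add: fg)
  have fg_span: "spanning d f g"
    using spanning_special[OF d0 UW(1) degree_form_poly degree_form_poly ab(2)] by (simp add: fg)
  define F where "F = form_poly d (\<lambda>i. t ^ (d - i) * Polynomial.coeff f i)"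
  \<comment> \<open>The extra factor \<open>t\<close> against \<open>F\<close> comes from the
    adjugate of diag(lt, l), which multiplies the first form by \<open>l\<close> and the second by
    \<open>l * t\<close>.\<close>
  define G where "G = form_poly d (\<lambda>i. t ^ Suc (d - i) * Polynomial.coeff g i)"
  have FG_deg: "Polynomial.degree F \<le> d" "Polynomial.degree G \<le> d"
    unfolding F_def G_def by (rule degree_form_poly)+
  have FG_over: "F \<in> polys_over" "G \<in> polys_over"
    unfolding F_def G_def using t(1) fg_over
    by (auto simp: polys_over_def coeff_form_poly)
  have pow: "l * l ^ (d - i) * l ^ i = l ^ Suc d" if "i \<le> d" for i
    using that by (simp flip: power_add)
  have diag: "poly_conj d (l * t, 0, 0, l) (f, g) = (Polynomial.smult (l ^ Suc d) F, Polynomial.smult (l ^ Suc d) G)"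
  proof -
    have "l * (l * t) ^ (d - i) * l ^ i = l ^ Suc d * t ^ (d - i)" if "i \<le> d" for i
    proof -
      have "l * (l * t) ^ (d - i) * l ^ i = (l * l ^ (d - i) * l ^ i) * t ^ (d - i)"
        by (simp only: power_mult_distrib mult_ac)
      then show ?thesis by (simp only: pow[OF that])
    qed
    then show ?thesis
      by (auto intro!: poly_eqI simp: coeff_hsubst_diag F_def G_def coeff_form_poly)
  qed
  have diag1: "poly_conj d (t, 0, 0, 1) (f, g) = (F, G)"
    by (auto intro!: poly_eqI simp: coeff_hsubst_diag F_def G_def coeff_form_poly)
  \<comment> \<open>The total scalar: \<open>k\<close> together with the \<open>d + 1\<close>
    factors \<open>l\<close> from the scalar part of the Smith form.\<close>
  define \<kappa> where "\<kappa> = k * l ^ Suc d"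
  have kappa: "\<kappa> \<noteq> 0" using k l by (simp add: \<kappa>_def)
  obtain P Q where PQ: "poly_conj d W (F, G) = (P, Q)"
    by (cases "poly_conj d W (F, G)")
  have "poly_conj d \<Gamma> (form_poly d a, form_poly d b) = poly_conj d W (poly_conj d (l * t, 0, 0, l) (f, g))"
    unfolding \<Gamma>_eq fg[symmetric] by (simp only: poly_conj_mult matrix2_mult_assoc)
  also have "\<dots> = (Polynomial.smult (l ^ Suc d) P, Polynomial.smult (l ^ Suc d) Q)"
    unfolding diag poly_conj_smult PQ by simp
  finally have model: "form_poly d a' = Polynomial.smult \<kappa> P" "form_poly d b' = Polynomial.smult \<kappa> Q"
    using conj by (simp_all add: \<kappa>_def)
  have PQ_over: "P \<in> polys_over" "Q \<in> polys_over"
    using polys_over_special[OF UW(2) FG_over, of d] by (simp_all add: PQ)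
  have PQ_deg: "Polynomial.degree P \<le> d" "Polynomial.degree Q \<le> d"
    using degree_poly_conj[of d W "(F, G)"] by (simp_all add: PQ)
  show ?thesis
  proof (cases "unit t")
    case True
    have "spanning d F G"
      using spanning_poly_conj[OF d0 _ _ _ fg_deg fg_span, of t 0 0 1] True t
      unfolding diag1 by (simp add: unit_def)
    then have "spanning d P Q"
      using spanning_special[OF d0 UW(2) FG_deg] by (simp add: PQ)
    then have "resultant_exponent S d (Polynomial.coeff P, Polynomial.coeff Q) = 0"
      using PQ_over PQ_deg d0
      by (intro resultant_exponent_zero_of_spanning) (auto simp: polys_over_def form_poly_coeff)
    moreover have "inverse \<kappa> * a' i = Polynomial.coeff P i" "inverse \<kappa> * b' i = Polynomial.coeff Q i" if "i \<le> d" for i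
      using that kappa arg_cong[OF model(1), of "\<lambda>p. Polynomial.coeff p i"]
        arg_cong[OF model(2), of "\<lambda>p. Polynomial.coeff p i"] by (simp_all add: coeff_form_poly)
    then have "resultant_exponent S d (\<lambda>i. inverse \<kappa> * a' i, \<lambda>i. inverse \<kappa> * b' i) =
        resultant_exponent S d (Polynomial.coeff P, Polynomial.coeff Q)"
      by (intro resultant_exponent_cong) auto
    ultimately show ?thesis
      using resultant_exponent_scale[OF d0 _ res, of "inverse \<kappa>"] kappa by simp
  next
    case False
    then have t_max: "t \<in> max_ideal S"
      using t(1) unit_iff_not_max_ideal by blast
    obtain c where c: "c \<noteq> 0" "min_val S d (\<lambda>i. c * a' i, \<lambda>i. c * b' i) = 0"
      "\<not> unstable (residue_field S) d (\<lambda>i. residue S (c * a' i), \<lambda>i. residue S (c * b' i))"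
      using semistable by auto
    have "form_resultant d (\<lambda>i. c * a' i, \<lambda>i. c * b' i) \<noteq> 0"
      unfolding form_resultant_scale using c(1) res by simp
    from integral_iff_min_val[OF nonzero_coords_nonempty[OF d0 this]]
    have AB: "c * a' i \<in> S \<and> c * b' i \<in> S" if "i \<le> d" for i
      unfolding c(2) using that by simp
    \<comment> \<open>Undoing \<open>W\<close> on the normalized model gives \<open>\<mu>\<close>
      times the diagonal conjugate \<open>(F, G)\<close>; the claim is that this pair has the
      vanishing pattern of an unstable point.\<close>
    define \<mu> where "\<mu> = c * \<kappa>"
    have W: "det2 W \<noteq> 0" using UW(2) by (simp add: special_def)
    have "poly_conj d (inv2 W) (P, Q) = (F, G)"
      unfolding PQ[symmetric] by (rule poly_conj_inv2[OF W FG_deg])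
    then have unconj: "poly_conj d (inv2 W) (form_poly d (\<lambda>i. c * a' i), form_poly d (\<lambda>i. c * b' i)) =
        (Polynomial.smult \<mu> F, Polynomial.smult \<mu> G)"
      unfolding form_poly_scale model poly_conj_smult[of d "inv2 W" c] poly_conj_smult[of d "inv2 W" \<kappa>]
      by (simp add: \<mu>_def)
    have "form_poly d (\<lambda>i. c * a' i) \<in> polys_over" "form_poly d (\<lambda>i. c * b' i) \<in> polys_over"
      using AB by (auto intro!: polys_over_form_poly)
    from polys_over_special[OF special_inv2[OF UW(2)] this, of d]
    have "Polynomial.smult \<mu> F \<in> polys_over" "Polynomial.smult \<mu> G \<in> polys_over"
      by (simp_all add: unconj)
    then have "\<mu> * Polynomial.coeff F d \<in> S" "\<mu> * Polynomial.coeff G d \<in> S"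
      by (simp_all add: polys_over_def)
    then have top: "\<mu> * Polynomial.coeff f d \<in> S" "\<mu> * t * Polynomial.coeff g d \<in> S"
      by (simp_all add: F_def G_def coeff_form_poly mult.assoc)
    have cancel: "x \<in> S" if "x * y \<in> S" "unit y" for x y
    proof -
      have "x = x * y * inverse y" using that(2) by (simp add: unit_def)
      moreover have "x * y * inverse y \<in> S"
        using that mult_mem[OF that(1), of "inverse y"] unfolding unit_def by blast
      ultimately show ?thesis by metis
    qed
    \<comment> \<open>\<open>\<mu>\<close> need not be integral. Integrality at index
      \<open>d\<close>, where \<open>F\<close> has weight 0 and \<open>G\<close> weight 1, combined
      with the unit top coefficient, controls \<open>\<mu> * t\<close>.\<close>
    have mu_t: "\<mu> * t \<in> S"
      using spanning_top_unit[OF d0 fg_deg fg_over fg_span]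
    proof
      assume "unit (Polynomial.coeff f d)"
      then have "\<mu> \<in> S" using cancel top(1) by blast
      then show ?thesis using t(1) by simp
    next
      assume "unit (Polynomial.coeff g d)"
      then show ?thesis using cancel top(2) by blast
    qed
    \<comment> \<open>One factor \<open>t\<close> makes \<open>\<mu>\<close> integral, a second one
      lands in the maximal ideal.\<close>
    have small: "\<mu> * (t ^ Suc (Suc n) * x) \<in> max_ideal S" if "x \<in> S" for n x
    proof -
      have "t * ((\<mu> * t) * (t ^ n * x)) \<in> max_ideal S"
        by (intro max_ideal_mult t_max mult_mem[OF mu_t] mult_mem power_mem t(1) that)
      then show ?thesis by (simp add: mult_ac)
    qed
    have "unstable (residue_field S) d (\<lambda>i. residue S (c * a' i), \<lambda>i. residue S (c * b' i))"
    proof (rule unstable_reduction[OF _ special_inv2[OF UW(2)] unconj])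
      show "c * a' i \<in> S \<and> c * b' i \<in> S" if "i \<le> d" for i
        using AB that .
      show "Polynomial.coeff (Polynomial.smult \<mu> F) i \<in> max_ideal S"
        if "i \<le> d" "real i \<le> (real d - 1) / 2" for i
      proof -
        \<comment> \<open>The weight of \<open>F\<close> at \<open>i\<close> is d-i, so i+2 <= d is
          needed: from d > 1 if i = 0, from 2i+1 <= d otherwise.\<close>
        have "real (2 * i + 1) \<le> real d" using that(2) by simp
        then have "2 * i + 1 \<le> d" by (simp only: of_nat_le_iff)
        then have "i + 2 \<le> d" using d by (cases i) auto
        then obtain n where "d - i = Suc (Suc n)"
          using that[of "d - i - 2"] by simp
        then show ?thesis
          using small[of "Polynomial.coeff f i" n] that(1) fg_over
          by (simp add: F_def coeff_form_poly polys_over_def del: power_Suc)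
      qed
      show "Polynomial.coeff (Polynomial.smult \<mu> G) i \<in> max_ideal S"
        if "i \<le> d" "real i \<le> (real d + 1) / 2" for i
      proof -
        \<comment> \<open>The weight of \<open>G\<close> at \<open>i\<close> is d+1-i, so i < d
          suffices; equality i = d would force d <= 1.\<close>
        have "real (2 * i) \<le> real (d + 1)" using that(2) by simp
        then have "2 * i \<le> d + 1" by (simp only: of_nat_le_iff)
        then have "i < d" using d by linarith
        then obtain n where "d - i = Suc n"
          by (metis Suc_diff_Suc)
        then show ?thesis
          using small[of "Polynomial.coeff g i" n] that(1) fg_over
          by (simp add: G_def coeff_form_poly polys_over_def del: power_Suc)
      qed
    qed
    then show ?thesis using c(3) by contradiction
  qed
qed

end

lemma (in dvr_in_field) semistable_presentation_exponent:
  assumes d: "1 < d"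
    and \<Psi>: "presentation d \<phi> \<Psi>" "resultant_exponent S d \<Psi> = 0"
    and ab: "presentation d \<phi> (a, b)" "semistable_reduction S d (a, b)"
  shows "resultant_exponent S d (a, b) = 0"
proof -
  have d0: "0 < d" using d by simp
  obtain a' b' where \<Psi>_eq: "\<Psi> = (a', b')" by (cases \<Psi>)
  have res': "form_resultant d (a', b') \<noteq> 0" and res: "form_resultant d (a, b) \<noteq> 0"
    using presentation_resultant_nonzero[OF d0] \<Psi>(1) ab(1) \<Psi>_eq by blast+
  obtain c where c: "c \<noteq> 0" "\<And>i. i \<le> d \<Longrightarrow> c * a' i \<in> S \<and> c * b' i \<in> S"
    "spanning d (form_poly d (\<lambda>i. c * a' i)) (form_poly d (\<lambda>i. c * b' i))"
    using spanning_of_resultant_exponent_zero[OF d0 res'] \<Psi>(2) \<Psi>_eq by blast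
  obtain e \<Gamma> where e: "e \<noteq> 0" "det2 \<Gamma> \<noteq> 0" "(form_poly d a, form_poly d b) =
      poly_conj d \<Gamma> (form_poly d (\<lambda>i. e * a' i), form_poly d (\<lambda>i. e * b' i))"
    using presentations_conjugate[OF d0 \<Psi>(1)[unfolded \<Psi>_eq] ab(1)] by blast
  \<comment> \<open>The matrix relates \<open>(a, b)\<close> to the model scaled by
    \<open>e\<close>, whereas the model with unit resultant is the one scaled by
    \<open>c\<close>.\<close>
  let ?k = "e / c"
  have "(form_poly d a, form_poly d b) = map_prod (Polynomial.smult ?k) (Polynomial.smult ?k)
      (poly_conj d \<Gamma> (form_poly d (\<lambda>i. c * a' i), form_poly d (\<lambda>i. c * b' i)))"
    unfolding e(3) poly_conj_smult[symmetric] using c(1) by (simp add: form_poly_scale)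
  then show ?thesis
    using semistable_conjugate[OF d c(2,3) e(2), of ?k a b] e(1) c(1) ab(2) res by simp
qed

section \<open>The curve\<close>

text \<open>That the local ring is a discrete valuation ring does not tell its fraction field. The
  chart does: the field consists of fractions over \<open>A\<close>, and \<open>A\<close> lies in
  the local ring, with denominator 1.\<close>

lemma local_ring_dvr:
  fixes \<O> :: "'p \<Rightarrow> 'k::field_char_0 set"
  assumes "dvr_curve C \<O>" "p \<in> closed_points C"
  obtains \<pi> where "dvr_in_field (\<O> p) \<pi>"
proof -
  have "closedin C {p}"
    using assms(2) by (simp add: closed_points_def)
  then have "p \<in> topspace C"
    using closedin_subset by fastforce
  then obtain U A where UA: "p \<in> U" "affine_chart C \<O> U A"
    using assms(1) unfolding dvr_curve_def noetherian_integral_scheme_def by blast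
  then obtain h where h: "homeomorphic_map (subtopology C U) (zariski_topology A) h"
      "\<forall>x\<in>U. \<O> x = localization_at A (h x)"
    and frac: "\<forall>z. \<exists>a\<in>A. \<exists>b\<in>A. b \<noteq> 0 \<and> z = a / b" and A: "subring A base_field"
    unfolding affine_chart_def by blast
  have "p \<in> topspace (subtopology C U)"
    using UA(1) \<open>p \<in> topspace C\<close> by simp
  then have "h p \<in> topspace (zariski_topology A)"
    using homeomorphic_imp_surjective_map[OF h(1)] by blast
  then have "h p \<in> spectrum A"
    unfolding zariski_topology_def topology_generated_by_topspace by auto
  then interpret P: primeideal "h p" "sub_ring A"
    by (simp add: spectrum_def)
  have "1 \<notin> h p"
    using P.one_imp_carrier P.I_notcarr by auto
  moreover have "1 \<in> A"
    using subringE(3)[OF A] by simp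
  ultimately have sub: "A \<subseteq> \<O> p"
    using h(2) UA(1) by (force simp: localization_at_def)
  have "\<exists>a\<in>\<O> p. \<exists>b\<in>\<O> p. b \<noteq> 0 \<and> z = a / b" for z
    using frac sub by blast
  moreover have "discrete_valuation_ring (sub_ring (\<O> p))"
    using assms by (simp add: dvr_curve_def)
  ultimately show ?thesis
    using dvr_in_field_of_discrete_valuation_ring that by blast
qed

text \<open>An infimum of integers bounded below is attained, so vanishing of the minimal resultant
  yields an actual presentation with exponent 0.\<close>

lemma int_INF_eq_0_iff:
  fixes f :: "'a \<Rightarrow> int"
  assumes "A \<noteq> {}" "\<And>x. x \<in> A \<Longrightarrow> 0 \<le> f x"
  shows "(INF x\<in>A. f x) = 0 \<longleftrightarrow> (\<exists>x\<in>A. f x = 0)"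
proof
  assume inf: "(INF x\<in>A. f x) = 0"
  show "\<exists>x\<in>A. f x = 0"
  proof (rule ccontr)
    assume "\<not> ?thesis"
    then have "1 \<le> f x" if "x \<in> A" for x
      using assms(2)[OF that] that by force
    then have "1 \<le> (INF x\<in>A. f x)"
      using assms(1) by (intro cINF_greatest)
    then show False using inf by simp
  qed
next
  assume "\<exists>x\<in>A. f x = 0"
  then obtain x where x: "x \<in> A" "f x = 0" by blast
  have "bdd_below (f ` A)"
    using assms(2) by (intro bdd_belowI[of _ 0]) auto
  then have "(INF x\<in>A. f x) \<le> 0"
    using cINF_lower[of f A x] x by simp
  moreover have "0 \<le> (INF x\<in>A. f x)"
    using assms by (intro cINF_greatest)
  ultimately show "(INF x\<in>A. f x) = 0" by simp
qed

theorem theorem4p1: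
  fixes C :: "'p topology" and \<O> :: "'p \<Rightarrow> 'k::field_char_0 set"
    and d :: nat and \<phi> :: "'k line_map" and a b :: "'k form"
  assumes "dvr_curve C \<O>"
    and "d > 1" and "morphism_of_degree d \<phi>"
    and "semistable_presentation C \<O> d \<phi> (a, b)"
  shows "nonsingular_locus C \<O> d (a, b) = good_reduction_locus C \<O> d \<phi>"
proof -
  have pres: "presentation d \<phi> (a, b)"
    and semistable: "\<And>p. p \<in> closed_points C \<Longrightarrow> semistable_reduction (\<O> p) d (a, b)"
    using assms(4) by (auto simp: semistable_presentation_def simp del: semistable_reduction.simps)
  \<comment> \<open>The presentation \<open>(a, b)\<close> itself witnesses one direction; the other
    is the semi-stability argument applied to a presentation attaining 0.\<close>
  have iff: "minimal_resultant C \<O> d \<phi> p = 0 \<longleftrightarrow> resultant_exponent (\<O> p) d (a, b) = 0"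
    if p: "p \<in> closed_points C" for p
  proof -
    obtain \<pi> where "dvr_in_field (\<O> p) \<pi>"
      using local_ring_dvr[OF assms(1) p] .
    then interpret dvr_in_field "\<O> p" \<pi> .
    let ?P = "{\<Psi>. presentation d \<phi> \<Psi>}"
    have nonneg: "0 \<le> resultant_exponent (\<O> p) d \<Psi>" if "\<Psi> \<in> ?P" for \<Psi>
      using that assms(2) presentation_resultant_nonzero[of d \<phi>] resultant_exponent_nonneg[of d]
      by (cases \<Psi>) (auto simp del: form_resultant.simps)
    have "?P \<noteq> {}" using pres by blast
    from int_INF_eq_0_iff[OF this nonneg]
    have "minimal_resultant C \<O> d \<phi> p = 0 \<longleftrightarrow> (\<exists>\<Psi>\<in>?P. resultant_exponent (\<O> p) d \<Psi> = 0)"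
      unfolding minimal_resultant_def using p by simp
    then show ?thesis
      using semistable_presentation_exponent[OF assms(2) _ _ pres semistable[OF p]] pres by blast
  qed
  \<comment> \<open>Points that are not closed lie in both loci by definition: the first tests
    closed points only, and the minimal resultant is 0 elsewhere.\<close>
  have "x \<in> nonsingular_locus C \<O> d (a, b) \<longleftrightarrow> x \<in> good_reduction_locus C \<O> d \<phi>" for x
    using iff[of x]
    by (auto simp: nonsingular_locus_def good_reduction_locus_def divisor_support_def conductor_def
        minimal_resultant_def)
  then show ?thesis by blast
qed

end
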